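(* Let $n,m$ be coprime positive integers. The map $\hat x:[X\times\mathbb Z]\to\mathbb Z^{n|m}$ is a $\mathfrak T_{iso}$-equivariant bijection $\hat x:[X\times \mathbb Z]\to \mathbf O$ such that $\hat x[\emptyset,0]=\Lambda_0$.
   Context: Notation: $[k]=\{1,\dots,k\}$. An element of $\mathbb Z^{n|m}$ is written $\Lambda=(a_1,\dots,a_n|b_1,\dots,b_m)$ and is identified with $\sum_{i=1}^n a_i\epsilon_i-\sum_{j=1}^m b_j\delta_j$, where $\epsilon_1,\dots,\epsilon_n,\delta_1,\dots,\delta_m$ is a basis with bilinear form $(\epsilon_i,\epsilon_j)=\delta_{i,j}=-(\delta_i,\delta_j)$ (Kronecker delta), $(\epsilon_i,\delta_j)=0$; so $(\Lambda,\epsilon_i-\delta_j)=a_i-b_j$. Put $\Delta_1^+=\{\epsilon_i-\delta_j: i\in[n],j\in[m]\}$ and $\Delta_{iso}=\Delta_1^+\cup(-\Delta_1^+)$. $\mathfrak T_{iso}$ is the groupoid with base $\Delta_{iso}$ and non-identity morphisms $\rho_\alpha:\alpha\to-\alpha$, $\alpha\in\Delta_{iso}$ (with $\rho_{-\alpha}=\rho_\alpha^{-1}$). An action of $\mathfrak T_{iso}$ on a set $\mathbb X$ is a functor to the groupoid of all subsets of $\mathbb X$ with bijections as morphisms, i.e. subsets $\mathbb X_\alpha\subseteq \mathbb X$ ($\alpha\in\Delta_{iso}$) and mutually inverse bijections $\mathbb X_{\alpha}\leftrightarrow\mathbb X_{-\alpha}$ (the images of $\rho_{\pm\alpha}$).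 The orbits are the connected components of the graph on $\mathbb X$ with an edge $y\to F(\rho_\alpha)y$ whenever this is defined; the action is transitive if there is only one orbit. Action on $\mathbb Z^{n|m}$: for $\alpha=\epsilon_i-\delta_j\in\Delta_1^+$ let $\Pi_\alpha=\{\Lambda:(\Lambda,\alpha)=0\}$, $\Pi_{-\alpha}=\{\Lambda:(\Lambda,\alpha)=n-m\}$, $v_\alpha=n\epsilon_i-m\delta_j$, and $\tau_{\pm\alpha}:\Pi_{\pm\alpha}\to\Pi_{\mp\alpha}$, $\tau_{\pm\alpha}(\Lambda)=\Lambda\pm v_\alpha$ (so $\tau_\alpha$ adds $n$ to $a_i$ and $m$ to $b_j$). The morphism $\rho_{\pm\alpha}$ acts by $\tau_{\pm\alpha}$. Let $\Lambda_0=(m(n-1),\dots,m,0\,|\,0,n,\dots,n(m-1))$ and let $\mathbf O$ be the $\mathfrak T_{iso}$-orbit of $\Lambda_0$. Young diagrams: $X$ is the set of partitions $\lambda=(\lambda_1\ge\dots\ge\lambda_n)$ with $m\ge\lambda_1$, $\lambda_n\ge0$, viewed as Young diagrams in a rectangle with $n$ rows labelled from the top down by $\epsilon_1,\dots,\epsilon_n$ and $m$ columns labelled from left to right by $\delta_1,\dots,\delta_m$: row $\epsilon_{n+1-i}$ contains $\lambda_i$ boxes, starting at the left edge. $\emptyset=(0^n)$. The dual partition has $\lambda'_j=|\{i:\lambda_i\ge j\}|$, $j\in[m]$. For $\alpha=\epsilon_i-\delta_j$, $X_\alpha$ is the set of $\lambda\in X$ for which the box in row $\epsilon_i$, column $\delta_j$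 is not in $\lambda$ and adding it gives a Young diagram, denoted $t_\alpha(\lambda)$; $X_{-\alpha}$ is the set of $\lambda\in X$ for which this box is in $\lambda$ and removing it gives a Young diagram, denoted $t_{-\alpha}(\lambda)$. Equivalence relation: $\sim$ is the smallest equivalence relation on $X\times\mathbb Z$ such that (1) if $\lambda_1=m$, then $(\lambda,k)\sim(\lambda^{-_r},k+m)$ where $\lambda^{-_r}=(\lambda_2,\dots,\lambda_n,0)$; (2) if $\lambda'_1=n$, then $(\lambda,k)\sim(\lambda^{-_c},k+n)$ where $\lambda^{-_c}=(\lambda_1-1,\dots,\lambda_n-1)$. $[\lambda,k]$ denotes the class of $(\lambda,k)$ and $[X\times\mathbb Z]$ the set of classes. Rotations: $\nu(a_1,\dots,a_n|b_1,\dots,b_m)=(a_n,a_1,\dots,a_{n-1}|b_1,\dots,b_m)$ and $\eta(a_1,\dots,a_n|b_1,\dots,b_m)=(a_1,\dots,a_n|b_2,\dots,b_m,b_1)$; equivalently $\nu(\epsilon_i)=\epsilon_{i+1}$ (indices mod $n$), $\nu(\delta_j)=\delta_j$, $\eta(\delta_{j+1})=\delta_j$ (indices mod $m$), $\eta(\epsilon_i)=\epsilon_i$. Action on $[X\times\mathbb Z]$: since $m,n$ are coprime, every integer has the form $in+jm$ with $i,j\in\mathbb Z$, and $\eta^i\nu^j$ depends only on $in+jm$. For $\alpha\in\Delta_{iso}$ let $\mathcal X_\alpha$ be the set of classes that contain some $(\lambda,in+jm)$ with $\lambda\in X_{\eta^i\nu^j\alpha}$; for such a representative, $\rho_\alpha$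 acts by $T_\alpha[\lambda,in+jm]=[t_{\eta^i\nu^j\alpha}(\lambda),in+jm]$ (a well-defined action). The map $\hat x$: for $\lambda\in X$ let $x(\lambda)=(a_1,\dots,a_n|b_1,\dots,b_m)$ with $a_i=m(n-i)+n\lambda_{n+1-i}$, $b_j=n(j-1)+m\lambda'_j$. For an integer $c$ let $\mathbf c=(c,\dots,c|c,\dots,c)$. Then $\hat x[\lambda,in+jm]=\eta^{-i}\nu^{-j}x(\lambda)+i\mathbf n+j\mathbf m$, which is well defined on equivalence classes. A $\mathfrak T_{iso}$-equivariant bijection between sets $\mathbb X,\mathbb Y$ with $\mathfrak T_{iso}$-actions is a bijection $\omega:\mathbb X\to\mathbb Y$ such that both actions are transitive, $\omega(\mathbb X_\alpha)=\mathbb Y_\alpha$ for all $\alpha\in\Delta_{iso}$, and $\omega$ intertwines the actions of each $\rho_\alpha$. Here $\mathbb X=[X\times\mathbb Z]$ with $\mathbb X_\alpha=\mathcal X_\alpha$, and $\mathbb Y=\mathbf O$ with $\mathbb Y_\alpha=\mathbf O\cap\Pi_\alpha$. *)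

theory Defs
  imports Main "HOL-Library.Function_Algebras" "HOL-Library.Product_Plus"
begin

text \<open>Throughout, \<open>n\<close> and \<open>m\<close> are the two parameters; indices run over \<open>{1..n}\<close> and \<open>{1..m}\<close>.\<close>

definition int_pow :: "('a \<Rightarrow> 'a) \<Rightarrow> int \<Rightarrow> 'a \<Rightarrow> 'a" where
  "int_pow f k = (if 0 \<le> k then f ^^ nat k else inv f ^^ nat (- k))"


subsection \<open>The lattice\<close>

text \<open>
  The vector \<open>(a\<^sub>1,\<dots>,a\<^sub>n | b\<^sub>1,\<dots>,b\<^sub>m)\<close> is the pair \<open>(a, b)\<close> of functions vanishing outside the
  index ranges. Under the identification with \<open>\<Sum> a\<^sub>i \<epsilon>\<^sub>i - \<Sum> b\<^sub>j \<delta>\<^sub>j\<close>, the second component of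
  \<open>\<delta>\<^sub>j\<close> is \<open>-1\<close> at \<open>j\<close>. Addition is the componentwise one of the library.
\<close>

type_synonym svec = "(nat \<Rightarrow> int) \<times> (nat \<Rightarrow> int)"

definition lattice :: "nat \<Rightarrow> nat \<Rightarrow> svec set" where
  "lattice n m = {(a, b). (\<forall>i. i \<notin> {1..n} \<longrightarrow> a i = 0) \<and> (\<forall>j. j \<notin> {1..m} \<longrightarrow> b j = 0)}"

definition eps :: "nat \<Rightarrow> svec" where
  "eps i = ((\<lambda>k. if k = i then 1 else 0), (\<lambda>_. 0))"

definition delta :: "nat \<Rightarrow> svec" where
  "delta j = ((\<lambda>_. 0), (\<lambda>k. if k = j then - 1 else 0))"

definition scale :: "int \<Rightarrow> svec \<Rightarrow> svec" where
  "scale c \<Lambda> = ((\<lambda>i. c * fst \<Lambda> i), (\<lambda>j. c * snd \<Lambda> j))"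

definition form :: "nat \<Rightarrow> nat \<Rightarrow> svec \<Rightarrow> svec \<Rightarrow> int" where
  "form n m \<Lambda> \<Theta> = (\<Sum>i=1..n. fst \<Lambda> i * fst \<Theta> i) - (\<Sum>j=1..m. snd \<Lambda> j * snd \<Theta> j)"

definition const_vec :: "nat \<Rightarrow> nat \<Rightarrow> int \<Rightarrow> svec" where
  "const_vec n m c = ((\<lambda>i. if i \<in> {1..n} then c else 0), (\<lambda>j. if j \<in> {1..m} then c else 0))"


subsection \<open>Isotropic roots\<close>

text \<open>\<open>eps_delta i j\<close> stands for \<open>\<epsilon>\<^sub>i - \<delta>\<^sub>j\<close> and \<open>delta_eps i j\<close> for its negative \<open>\<delta>\<^sub>j - \<epsilon>\<^sub>i\<close>.\<close>

datatype iso_root = eps_delta nat nat | delta_eps nat nat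

fun neg_root :: "iso_root \<Rightarrow> iso_root" where
  "neg_root (eps_delta i j) = delta_eps i j"
| "neg_root (delta_eps i j) = eps_delta i j"

fun root_vec :: "iso_root \<Rightarrow> svec" where
  "root_vec (eps_delta i j) = eps i - delta j"
| "root_vec (delta_eps i j) = delta j - eps i"

definition Delta_iso :: "nat \<Rightarrow> nat \<Rightarrow> iso_root set" where
  "Delta_iso n m = {eps_delta i j | i j. i \<in> {1..n} \<and> j \<in> {1..m}} \<union>
                   {delta_eps i j | i j. i \<in> {1..n} \<and> j \<in> {1..m}}"

lemma form_eps_minus_delta:
  assumes "i \<in> {1..n}" "j \<in> {1..m}"
  shows "form n m (a, b) (root_vec (eps_delta i j)) = a i - b j"
proof -
  have "fst (root_vec (eps_delta i j)) k = (if k = i then 1 else 0)"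
    and "snd (root_vec (eps_delta i j)) k = (if k = j then 1 else 0)" for k
    by (auto simp: eps_def delta_def)
  then show ?thesis
    using assms by (simp add: form_def if_distrib[of "\<lambda>x. _ * x"] del: root_vec.simps cong: if_cong)
qed


subsection \<open>Actions of the groupoid\<close>

text \<open>
  An action on \<open>S\<close> is given by the subsets \<open>D \<alpha>\<close> and by the images \<open>F \<alpha>\<close> of the morphisms
  \<open>\<rho>\<^sub>\<alpha> : \<alpha> \<rightarrow> -\<alpha>\<close>. The values of \<open>F \<alpha>\<close> outside \<open>D \<alpha>\<close> are irrelevant.
\<close>

definition iso_action ::
  "nat \<Rightarrow> nat \<Rightarrow> 'x set \<Rightarrow> (iso_root \<Rightarrow> 'x set) \<Rightarrow> (iso_root \<Rightarrow> 'x \<Rightarrow> 'x) \<Rightarrow> bool" where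
  "iso_action n m S D F \<longleftrightarrow>
     (\<forall>\<alpha>\<in>Delta_iso n m. D \<alpha> \<subseteq> S \<and> bij_betw (F \<alpha>) (D \<alpha>) (D (neg_root \<alpha>)) \<and>
        (\<forall>x\<in>D \<alpha>. F (neg_root \<alpha>) (F \<alpha> x) = x))"

definition action_edges ::
  "nat \<Rightarrow> nat \<Rightarrow> (iso_root \<Rightarrow> 'x set) \<Rightarrow> (iso_root \<Rightarrow> 'x \<Rightarrow> 'x) \<Rightarrow> ('x \<times> 'x) set" where
  "action_edges n m D F = {(y, F \<alpha> y) | y \<alpha>. \<alpha> \<in> Delta_iso n m \<and> y \<in> D \<alpha>}"

definition action_orbit ::
  "nat \<Rightarrow> nat \<Rightarrow> (iso_root \<Rightarrow> 'x set) \<Rightarrow> (iso_root \<Rightarrow> 'x \<Rightarrow> 'x) \<Rightarrow> 'x \<Rightarrow> 'x set" where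
  "action_orbit n m D F x = (action_edges n m D F \<union> (action_edges n m D F)\<inverse>)\<^sup>* `` {x}"

definition transitive_action ::
  "nat \<Rightarrow> nat \<Rightarrow> 'x set \<Rightarrow> (iso_root \<Rightarrow> 'x set) \<Rightarrow> (iso_root \<Rightarrow> 'x \<Rightarrow> 'x) \<Rightarrow> bool" where
  "transitive_action n m S D F \<longleftrightarrow> (\<exists>C. action_orbit n m D F ` S = {C})"

definition equivariant_bijection ::
  "nat \<Rightarrow> nat \<Rightarrow> ('x \<Rightarrow> 'y) \<Rightarrow>
   'x set \<Rightarrow> (iso_root \<Rightarrow> 'x set) \<Rightarrow> (iso_root \<Rightarrow> 'x \<Rightarrow> 'x) \<Rightarrow>
   'y set \<Rightarrow> (iso_root \<Rightarrow> 'y set) \<Rightarrow> (iso_root \<Rightarrow> 'y \<Rightarrow> 'y) \<Rightarrow> bool" where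
  "equivariant_bijection n m \<omega> S D F S' D' F' \<longleftrightarrow>
     iso_action n m S D F \<and> iso_action n m S' D' F' \<and>
     bij_betw \<omega> S S' \<and>
     transitive_action n m S D F \<and> transitive_action n m S' D' F' \<and>
     (\<forall>\<alpha>\<in>Delta_iso n m. \<omega> ` D \<alpha> = D' \<alpha> \<and> (\<forall>x\<in>D \<alpha>. \<omega> (F \<alpha> x) = F' \<alpha> (\<omega> x)))"


subsection \<open>The action on the lattice\<close>

fun hyperplane :: "nat \<Rightarrow> nat \<Rightarrow> iso_root \<Rightarrow> svec set" where
  "hyperplane n m (eps_delta i j) =
     {\<Lambda> \<in> lattice n m. form n m \<Lambda> (root_vec (eps_delta i j)) = 0}"
| "hyperplane n m (delta_eps i j) =
     {\<Lambda> \<in> lattice n m. form n m \<Lambda> (root_vec (eps_delta i j)) = int n - int m}"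

definition shift_vec :: "nat \<Rightarrow> nat \<Rightarrow> nat \<Rightarrow> nat \<Rightarrow> svec" where
  "shift_vec n m i j = scale (int n) (eps i) - scale (int m) (delta j)"

fun tau :: "nat \<Rightarrow> nat \<Rightarrow> iso_root \<Rightarrow> svec \<Rightarrow> svec" where
  "tau n m (eps_delta i j) \<Lambda> = \<Lambda> + shift_vec n m i j"
| "tau n m (delta_eps i j) \<Lambda> = \<Lambda> - shift_vec n m i j"

definition Lambda0 :: "nat \<Rightarrow> nat \<Rightarrow> svec" where
  "Lambda0 n m = ((\<lambda>i. if i \<in> {1..n} then int m * (int n - int i) else 0),
                  (\<lambda>j. if j \<in> {1..m} then int n * (int j - 1) else 0))"

definition Lambda0_orbit :: "nat \<Rightarrow> nat \<Rightarrow> svec set" where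
  "Lambda0_orbit n m = action_orbit n m (hyperplane n m) (tau n m) (Lambda0 n m)"


subsection \<open>Rotations\<close>

text \<open>
  The rotations are the identity on indices outside the ranges, so that they are bijections of the
  full types and their integer powers make sense.
\<close>

definition nu :: "nat \<Rightarrow> svec \<Rightarrow> svec" where
  "nu n \<Lambda> = ((\<lambda>i. if i \<in> {1..n} then (if i = 1 then fst \<Lambda> n else fst \<Lambda> (i - 1)) else fst \<Lambda> i),
             snd \<Lambda>)"

definition eta :: "nat \<Rightarrow> svec \<Rightarrow> svec" where
  "eta m \<Lambda> = (fst \<Lambda>,
              (\<lambda>j. if j \<in> {1..m} then (if j = m then snd \<Lambda> 1 else snd \<Lambda> (j + 1)) else snd \<Lambda> j))"

definition cyc_succ :: "nat \<Rightarrow> nat \<Rightarrow> nat" where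
  "cyc_succ k i = (if i \<in> {1..k} then (if i = k then 1 else i + 1) else i)"

definition cyc_pred :: "nat \<Rightarrow> nat \<Rightarrow> nat" where
  "cyc_pred k i = (if i \<in> {1..k} then (if i = 1 then k else i - 1) else i)"

fun nu_root :: "nat \<Rightarrow> iso_root \<Rightarrow> iso_root" where
  "nu_root n (eps_delta i j) = eps_delta (cyc_succ n i) j"
| "nu_root n (delta_eps i j) = delta_eps (cyc_succ n i) j"

fun eta_root :: "nat \<Rightarrow> iso_root \<Rightarrow> iso_root" where
  "eta_root m (eps_delta i j) = eps_delta i (cyc_pred m j)"
| "eta_root m (delta_eps i j) = delta_eps i (cyc_pred m j)"

text \<open>The rotations of roots are those of the corresponding vectors.\<close>

lemma root_vec_nu_root: "root_vec (nu_root n \<alpha>) = nu n (root_vec \<alpha>)"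
  by (cases \<alpha>) (auto simp: nu_def eps_def delta_def cyc_succ_def fun_eq_iff)

lemma root_vec_eta_root: "root_vec (eta_root m \<alpha>) = eta m (root_vec \<alpha>)"
  by (cases \<alpha>) (auto simp: eta_def eps_def delta_def cyc_pred_def fun_eq_iff)


subsection \<open>Young diagrams\<close>

text \<open>
  A partition is a function on \<open>{1..n}\<close>, extended by zero. A box is a pair \<open>(i, j)\<close> of a row label
  \<open>\<epsilon>\<^sub>i\<close> and a column label \<open>\<delta>\<^sub>j\<close>; row \<open>\<epsilon>\<^sub>i\<close>
  of \<open>p\<close> has \<open>p (n + 1 - i)\<close> boxes.
\<close>

type_synonym part = "nat \<Rightarrow> nat"

definition diagrams :: "nat \<Rightarrow> nat \<Rightarrow> part set" where
  "diagrams n m = {p. (\<forall>i\<in>{1..n}. p i \<le> m) \<and> (\<forall>i\<in>{1..<n}. p (i + 1) \<le> p i) \<and>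
                      (\<forall>i. i \<notin> {1..n} \<longrightarrow> p i = 0)}"

definition empty_part :: part where
  "empty_part = (\<lambda>_. 0)"

definition dual_part :: "nat \<Rightarrow> part \<Rightarrow> nat \<Rightarrow> nat" where
  "dual_part n p j = card {i \<in> {1..n}. j \<le> p i}"

definition boxes :: "nat \<Rightarrow> nat \<Rightarrow> part \<Rightarrow> (nat \<times> nat) set" where
  "boxes n m p = {(i, j). i \<in> {1..n} \<and> j \<in> {1..m} \<and> j \<le> p (n + 1 - i)}"

fun X_dom :: "nat \<Rightarrow> nat \<Rightarrow> iso_root \<Rightarrow> part set" where
  "X_dom n m (eps_delta i j) =
     {p \<in> diagrams n m. (i, j) \<notin> boxes n m p \<and>
        (\<exists>\<mu>\<in>diagrams n m. boxes n m \<mu> = insert (i, j) (boxes n m p))}"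
| "X_dom n m (delta_eps i j) =
     {p \<in> diagrams n m. (i, j) \<in> boxes n m p \<and>
        (\<exists>\<mu>\<in>diagrams n m. boxes n m \<mu> = boxes n m p - {(i, j)})}"

fun t_box :: "nat \<Rightarrow> nat \<Rightarrow> iso_root \<Rightarrow> part \<Rightarrow> part" where
  "t_box n m (eps_delta i j) p =
     (THE \<mu>. \<mu> \<in> diagrams n m \<and> boxes n m \<mu> = insert (i, j) (boxes n m p))"
| "t_box n m (delta_eps i j) p =
     (THE \<mu>. \<mu> \<in> diagrams n m \<and> boxes n m \<mu> = boxes n m p - {(i, j)})"


subsection \<open>Equivalence classes and the action on them\<close>

definition remove_row :: "nat \<Rightarrow> part \<Rightarrow> part" where
  "remove_row n p = (\<lambda>i. if i \<in> {1..<n} then p (i + 1) else 0)"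

text \<open>Only used when all \<open>n\<close> parts are positive, so the subtraction is never truncated.\<close>

definition remove_col :: "nat \<Rightarrow> part \<Rightarrow> part" where
  "remove_col n p = (\<lambda>i. if i \<in> {1..n} then p i - 1 else 0)"

definition sim_gen :: "nat \<Rightarrow> nat \<Rightarrow> ((part \<times> int) \<times> (part \<times> int)) set" where
  "sim_gen n m =
     {((p, k), (remove_row n p, k + int m)) | p k. p \<in> diagrams n m \<and> p 1 = m} \<union>
     {((p, k), (remove_col n p, k + int n)) | p k. p \<in> diagrams n m \<and> dual_part n p 1 = n}"

definition sim :: "nat \<Rightarrow> nat \<Rightarrow> ((part \<times> int) \<times> (part \<times> int)) set" where
  "sim n m = \<Inter> {R. equiv (diagrams n m \<times> UNIV) R \<and> sim_gen n m \<subseteq> R}"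

definition cls :: "nat \<Rightarrow> nat \<Rightarrow> part \<Rightarrow> int \<Rightarrow> (part \<times> int) set" where
  "cls n m p k = sim n m `` {(p, k)}"

definition classes :: "nat \<Rightarrow> nat \<Rightarrow> (part \<times> int) set set" where
  "classes n m = (diagrams n m \<times> UNIV) // sim n m"

definition rot_root :: "nat \<Rightarrow> nat \<Rightarrow> int \<Rightarrow> int \<Rightarrow> iso_root \<Rightarrow> iso_root" where
  "rot_root n m i j \<alpha> = int_pow (eta_root m) i (int_pow (nu_root n) j \<alpha>)"

definition class_dom :: "nat \<Rightarrow> nat \<Rightarrow> iso_root \<Rightarrow> (part \<times> int) set set" where
  "class_dom n m \<alpha> =
     {C \<in> classes n m. \<exists>p i j. (p, i * int n + j * int m) \<in> C \<and> p \<in> X_dom n m (rot_root n m i j \<alpha>)}"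

text \<open>
  The following two maps are given on representatives; \<open>THE\<close> quantifies over the value obtained from
  every admissible representative, so it denotes that value because it does not depend on the choice.
\<close>

definition class_act :: "nat \<Rightarrow> nat \<Rightarrow> iso_root \<Rightarrow> (part \<times> int) set \<Rightarrow> (part \<times> int) set" where
  "class_act n m \<alpha> C =
     (THE D. \<exists>p i j. (p, i * int n + j * int m) \<in> C \<and> p \<in> X_dom n m (rot_root n m i j \<alpha>) \<and>
        D = cls n m (t_box n m (rot_root n m i j \<alpha>) p) (i * int n + j * int m))"

definition x_vec :: "nat \<Rightarrow> nat \<Rightarrow> part \<Rightarrow> svec" where
  "x_vec n m p =
     ((\<lambda>i. if i \<in> {1..n} then int m * (int n - int i) + int n * int (p (n + 1 - i)) else 0),
      (\<lambda>j. if j \<in> {1..m} then int n * (int j - 1) + int m * int (dual_part n p j) else 0))"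

definition xhat :: "nat \<Rightarrow> nat \<Rightarrow> (part \<times> int) set \<Rightarrow> svec" where
  "xhat n m C =
     (THE \<Lambda>. \<exists>p i j. (p, i * int n + j * int m) \<in> C \<and>
        \<Lambda> = int_pow (eta m) (- i) (int_pow (nu n) (- j) (x_vec n m p))
            + const_vec n m (i * int n) + const_vec n m (j * int m))"

end

theory Submission
  imports Defs
begin

text \<open>
  Give the box in row \<open>\<epsilon>\<^sub>i\<close> and column \<open>\<delta>\<^sub>j\<close> of a diagram with offset \<open>k\<close> the value
  \<open>k + m (n - i) + n (j - 1)\<close>. Adjoining all values to the left of the rectangle turns
  \<open>(\<lambda>, k)\<close> into a nonempty proper subset \<open>I\<close> of \<open>\<int>\<close> closed under subtraction of \<open>n\<close> and \<open>m\<close>.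
  As \<open>n\<close> and \<open>m\<close> are coprime, all such ideals arise, and two pairs give the same ideal iff they are
  equivalent. The \<open>a\<^sub>i\<close> and \<open>b\<^sub>j\<close> of \<open>xhat [\<lambda>, k]\<close> are the least elements of the complement of
  \<open>I\<close> in the residue classes modulo \<open>n\<close> and modulo \<open>m\<close>; they determine \<open>I\<close>. Adding or
  removing a box means toggling the membership of one integer \<open>x\<close> with prescribed residues modulo
  \<open>n\<close> and \<open>m\<close>; \<open>x\<close> can be added iff \<open>a\<^sub>i = x = b\<^sub>j\<close>, and removed iff
  \<open>a\<^sub>i - n = x = b\<^sub>j - m\<close>. Any two ideals differ by finitely many integers, so they are connected
  by such moves.
\<close>

subsection \<open>Integer powers and cyclic shifts\<close>

lemma int_pow_0 [simp]: "int_pow f 0 x = x"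
  by (simp add: int_pow_def)

lemma int_pow_plus1:
  assumes "bij f"
  shows "int_pow f (k + 1) x = f (int_pow f k x)"
proof (cases "0 \<le> k")
  case True
  then show ?thesis by (simp add: int_pow_def nat_add_distrib)
next
  case False
  then have "nat (- k) = Suc (nat (- (k + 1)))" by simp
  \<comment> \<open>At \<open>k = -1\<close> the exponent \<open>k + 1\<close> falls into the other
    branch of \<open>int_pow_def\<close>; both branches give the identity there.\<close>
  moreover have "int_pow f (k + 1) x = (inv f ^^ nat (- (k + 1))) x"
    using False by (cases "k = -1") (auto simp: int_pow_def)
  ultimately show ?thesis
    using False assms by (simp add: int_pow_def bij_is_surj surj_f_inv_f)
qed

text \<open>The step is an equivalence, so it can also be run downwards and reaches the negative
  integers.\<close>

lemma int_induct_iff: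
  assumes "P (0::int)" and step: "\<And>k. P (k + 1) \<longleftrightarrow> P k"
  shows "P k"
proof (induction k rule: int_induct[where k = 0])
  case (step2 i)
  then show ?case using step[of "i - 1"] by simp
qed (use assms in auto)

text \<open>Reduces each claim about integer powers of a rotation to one rotation step. The index
  \<open>k\<close> lets the property itself be translated along with the power.\<close>

lemma int_pow_invariant:
  assumes "bij f" and "\<And>k y. P (k + 1) (f y) \<longleftrightarrow> P k y"
  shows "P (k::int) (int_pow f k x) \<longleftrightarrow> P 0 x"
  by (rule int_induct_iff[of "\<lambda>k. P k (int_pow f k x) \<longleftrightarrow> P 0 x"])
     (simp_all add: int_pow_plus1 assms)

section \<open>Cyclic index shifts and bijectivity of the rotations\<close>

lemma cyc_pred_succ [simp]: "cyc_pred k (cyc_succ k i) = i" "cyc_succ k (cyc_pred k i) = i"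
  by (auto simp: cyc_pred_def cyc_succ_def)

lemma cyc_in_range [simp]:
  "cyc_pred k i \<in> {1..k} \<longleftrightarrow> i \<in> {1..k}" "cyc_succ k i \<in> {1..k} \<longleftrightarrow> i \<in> {1..k}"
  by (auto simp: cyc_pred_def cyc_succ_def)

lemma ball_cyc_pred: "(\<forall>i\<in>{1..k}. P (cyc_pred k i)) \<longleftrightarrow> (\<forall>i\<in>{1..k}. P i)"
  by (metis cyc_pred_succ(1) cyc_in_range)

lemma ball_cyc_succ: "(\<forall>i\<in>{1..k}. P (cyc_succ k i)) \<longleftrightarrow> (\<forall>i\<in>{1..k}. P i)"
  by (metis cyc_pred_succ(2) cyc_in_range)

lemma nu_eq: "nu k \<Lambda> = (fst \<Lambda> \<circ> cyc_pred k, snd \<Lambda>)"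
  by (auto simp: nu_def cyc_pred_def fun_eq_iff)

lemma eta_eq: "eta k \<Lambda> = (fst \<Lambda>, snd \<Lambda> \<circ> cyc_succ k)"
  by (auto simp: eta_def cyc_succ_def fun_eq_iff)

lemma bij_nu: "bij (nu k)"
  by (rule o_bij[of "\<lambda>\<Lambda>. (fst \<Lambda> \<circ> cyc_succ k, snd \<Lambda>)"]) (auto simp: nu_eq fun_eq_iff)

lemma bij_eta: "bij (eta k)"
  by (rule o_bij[of "\<lambda>\<Lambda>. (fst \<Lambda>, snd \<Lambda> \<circ> cyc_pred k)"]) (auto simp: eta_eq fun_eq_iff)

lemma bij_nu_root: "bij (nu_root k)"
proof (rule bijI)
  show "inj (nu_root k)"
  proof (rule injI)
    fix \<alpha> \<beta> assume "nu_root k \<alpha> = nu_root k \<beta>"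
    then show "\<alpha> = \<beta>" by (cases \<alpha>; cases \<beta>) (simp_all, (metis cyc_pred_succ(1))+)
  qed
  show "surj (nu_root k)"
  proof (rule surjI)
    fix \<alpha> show "nu_root k (case \<alpha> of eps_delta i j \<Rightarrow> eps_delta (cyc_pred k i) j
        | delta_eps i j \<Rightarrow> delta_eps (cyc_pred k i) j) = \<alpha>"
      by (cases \<alpha>) auto
  qed
qed

lemma bij_eta_root: "bij (eta_root k)"
proof (rule bijI)
  show "inj (eta_root k)"
  proof (rule injI)
    fix \<alpha> \<beta> assume "eta_root k \<alpha> = eta_root k \<beta>"
    then show "\<alpha> = \<beta>" by (cases \<alpha>; cases \<beta>) (simp_all, (metis cyc_pred_succ(2))+)
  qed
  show "surj (eta_root k)"
  proof (rule surjI)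
    fix \<alpha> show "eta_root k (case \<alpha> of eps_delta i j \<Rightarrow> eps_delta i (cyc_succ k j)
        | delta_eps i j \<Rightarrow> delta_eps i (cyc_succ k j)) = \<alpha>"
      by (cases \<alpha>) auto
  qed
qed

subsection \<open>Groupoid actions\<close>

lemma mem_Delta_iso [simp]:
  "eps_delta i j \<in> Delta_iso n m \<longleftrightarrow> i \<in> {1..n} \<and> j \<in> {1..m}"
  "delta_eps i j \<in> Delta_iso n m \<longleftrightarrow> i \<in> {1..n} \<and> j \<in> {1..m}"
  by (auto simp: Delta_iso_def)

lemma neg_root_Delta_iso [simp]: "neg_root \<alpha> \<in> Delta_iso n m \<longleftrightarrow> \<alpha> \<in> Delta_iso n m"
  by (cases \<alpha>) auto

lemma neg_neg_root [simp]: "neg_root (neg_root \<alpha>) = \<alpha>"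
  by (cases \<alpha>) auto

lemma nu_root_Delta_iso: "nu_root n \<alpha> \<in> Delta_iso n m \<longleftrightarrow> \<alpha> \<in> Delta_iso n m"
  by (cases \<alpha>) (simp_all del: atLeastAtMost_iff One_nat_def)

lemma eta_root_Delta_iso: "eta_root m \<alpha> \<in> Delta_iso n m \<longleftrightarrow> \<alpha> \<in> Delta_iso n m"
  by (cases \<alpha>) (simp_all del: atLeastAtMost_iff One_nat_def)

lemma action_edgesI:
  "\<alpha> \<in> Delta_iso n m \<Longrightarrow> y \<in> D \<alpha> \<Longrightarrow> (y, F \<alpha> y) \<in> action_edges n m D F"
  unfolding action_edges_def by blast

text \<open>The actions on classes and on the orbit are both obtained from the action on ideals by
  this transport.\<close>

lemma iso_action_transfer:
  assumes act: "iso_action n m S D F" and bij: "bij_betw \<omega> S S'"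
    and dom: "\<And>\<alpha>. \<alpha> \<in> Delta_iso n m \<Longrightarrow> \<omega> ` D \<alpha> = D' \<alpha>"
    and eqv: "\<And>\<alpha> x. \<alpha> \<in> Delta_iso n m \<Longrightarrow> x \<in> D \<alpha> \<Longrightarrow> \<omega> (F \<alpha> x) = F' \<alpha> (\<omega> x)"
  shows "iso_action n m S' D' F'"
  unfolding iso_action_def
proof (intro ballI conjI)
  fix \<alpha> assume \<alpha>: "\<alpha> \<in> Delta_iso n m"
  then have n\<alpha>: "neg_root \<alpha> \<in> Delta_iso n m" by simp
  have sub: "D \<beta> \<subseteq> S" and im: "F \<beta> ` D \<beta> = D (neg_root \<beta>)"
    and cancel: "x \<in> D \<beta> \<Longrightarrow> F (neg_root \<beta>) (F \<beta> x) = x" if "\<beta> \<in> Delta_iso n m" for \<beta> x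
    using act that by (auto simp: iso_action_def bij_betw_def)
  show "D' \<alpha> \<subseteq> S'"
    using dom[OF \<alpha>] sub[OF \<alpha>] bij by (auto simp: bij_betw_def)
  \<comment> \<open>Stated for arbitrary \<open>\<beta>\<close> because the bijection uses it at
    \<open>\<alpha>\<close> and at its negative: \<open>F' (neg_root \<alpha>)\<close> is a
    two-sided inverse.\<close>
  have back': "F' (neg_root \<beta>) (F' \<beta> y) = y" and into: "F' \<beta> y \<in> D' (neg_root \<beta>)"
    if \<beta>: "\<beta> \<in> Delta_iso n m" and y: "y \<in> D' \<beta>" for \<beta> y
  proof -
    obtain x where x: "x \<in> D \<beta>" "y = \<omega> x" using dom[OF \<beta>] y by auto
    have Fx: "F \<beta> x \<in> D (neg_root \<beta>)" using im[OF \<beta>] x by auto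
    have n\<beta>: "neg_root \<beta> \<in> Delta_iso n m" using \<beta> by simp
    show "F' (neg_root \<beta>) (F' \<beta> y) = y"
      using eqv[OF \<beta> x(1)] eqv[OF n\<beta> Fx] cancel[OF \<beta> x(1)] x(2) by simp
    show "F' \<beta> y \<in> D' (neg_root \<beta>)"
      using eqv[OF \<beta> x(1)] dom[OF n\<beta>] Fx x(2) by (metis imageI)
  qed
  show "F' (neg_root \<alpha>) (F' \<alpha> y) = y" if "y \<in> D' \<alpha>" for y
    using back'[OF \<alpha> that] .
  show "bij_betw (F' \<alpha>) (D' \<alpha>) (D' (neg_root \<alpha>))"
    using back'[OF \<alpha>] into[OF \<alpha>] back'[OF n\<alpha>] into[OF n\<alpha>]
    by (intro bij_betw_byWitness[where f' = "F' (neg_root \<alpha>)"]) auto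
qed

lemma rtrancl_transfer:
  assumes "(x, y) \<in> R\<^sup>*" and "\<And>a b. (a, b) \<in> R \<Longrightarrow> (\<omega> a, \<omega> b) \<in> R'"
  shows "(\<omega> x, \<omega> y) \<in> R'\<^sup>*"
  using assms(1) by induction (auto intro: rtrancl.rtrancl_into_rtrancl assms(2))

text \<open>The base point \<open>x0\<close> excludes an empty \<open>S\<close>, which would have no
  orbit instead of one.\<close>

lemma transitive_actionI:
  assumes "x0 \<in> S"
    and "\<And>x y. x \<in> S \<Longrightarrow> y \<in> S \<Longrightarrow>
      (x, y) \<in> (action_edges n m D F \<union> (action_edges n m D F)\<inverse>)\<^sup>*"
  shows "transitive_action n m S D F"
proof -
  have eq: "action_orbit n m D F x = action_orbit n m D F x0" if "x \<in> S" for x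
    using assms(2)[OF that assms(1)] assms(2)[OF assms(1) that]
    by (auto simp: action_orbit_def intro: rtrancl_trans)
  have "action_orbit n m D F ` S = {action_orbit n m D F x0}"
    by (intro equalityI subsetI) (metis eq imageE singletonI, metis assms(1) imageI singletonD)
  then show ?thesis unfolding transitive_action_def by blast
qed

subsection \<open>Ideals of the integers\<close>

locale coprime_pair =
  fixes n m :: nat
  assumes n_pos: "n > 0" and m_pos: "m > 0" and coprime_nm: "coprime n m"
begin

section \<open>Coordinates of integers with respect to \<open>n\<close> and \<open>m\<close>\<close>

lemma bezout: obtains i j where "(x::int) = i * int n + j * int m"
proof -
  obtain u v where "u * int n + v * int m = gcd (int n) (int m)"
    using bezout_int by blast
  also have "\<dots> = 1" using coprime_nm by (simp add: coprime_iff_gcd_eq_1[symmetric])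
  finally have "x * (u * int n + v * int m) = x" by simp
  then show ?thesis by (intro that[of "x * u" "x * v"]) (simp add: algebra_simps)
qed

text \<open>Reduce the coefficient of \<open>m\<close> in a Bezout representation modulo
  \<open>n\<close> and move the quotient into the coefficient of \<open>n\<close>. Here
  \<open>r = n - i\<close> stands for the row of \<open>\<epsilon>_i\<close> and
  \<open>c = j - 1\<close> for the column of \<open>\<delta>_j\<close>; \<open>c\<close> runs over
  all integers, so positions beside the rectangle are included.\<close>

lemma coordinates: obtains r c where "r < n" "(x::int) = k + int m * int r + int n * c"
proof -
  obtain u v where uv: "x - k = u * int n + v * int m" by (rule bezout)
  show ?thesis
  proof (rule that[of "nat (v mod int n)" "u + int m * (v div int n)"])
    show "nat (v mod int n) < n"
      using n_pos by (simp add: nat_less_iff)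
    have "int m * (v mod int n) + int n * (int m * (v div int n)) = v * int m"
      by (metis mod_mult_div_eq mult.commute mult.left_commute distrib_left)
    then show "x = k + int m * int (nat (v mod int n)) + int n * (u + int m * (v div int n))"
      using uv n_pos by (simp add: algebra_simps)
  qed
qed

lemma dvd_cancel_m: "int n dvd int m * x \<longleftrightarrow> int n dvd x"
  using coprime_nm by (simp add: coprime_dvd_mult_right_iff)

lemma dvd_cancel_n: "int m dvd int n * x \<longleftrightarrow> int m dvd x"
  using coprime_nm by (simp add: coprime_dvd_mult_right_iff coprime_commute)

lemma residue_unique:
  assumes "int k dvd int i - int j" "i \<in> {1..k}" "j \<in> {1..k}"
  shows "i = j"
proof -
  have "\<bar>int i - int j\<bar> < int k" using assms(2,3) by auto
  then have "int i - int j = 0" using assms(1) dvd_imp_le_int[of "int i - int j" "int k"] by force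
  then show ?thesis by simp
qed

lemma coordinates_unique:
  assumes "int m * int r + int n * c = int m * int r' + int n * c'" "r < n" "r' < n"
  shows "r = r'" "c = c'"
proof -
  have "int m * (int r - int r') = int n * (c' - c)" using assms(1) by (simp add: algebra_simps)
  then have "int n dvd int (Suc r) - int (Suc r')"
    using dvd_cancel_m[of "int r - int r'"] by (metis add_diff_cancel_left dvd_triv_left of_nat_Suc)
  then show "r = r'" using residue_unique[of n "Suc r" "Suc r'"] assms(2,3) by simp
  then show "c = c'" using assms(1) n_pos by simp
qed

text \<open>The column coordinate \<open>c\<close> may be negative, which supplies the values to the
  left of the rectangle. Row \<open>r\<close> has length \<open>p (Suc r)\<close>, so row
  \<open>r = 0\<close> is the longest.\<close>

definition ideal :: "part \<Rightarrow> int \<Rightarrow> int set" where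
  "ideal p k = {k + int m * int r + int n * c | r c. r < n \<and> c < int (p (Suc r))}"

definition ideals :: "int set set" where
  "ideals = {I. I \<noteq> {} \<and> I \<noteq> UNIV \<and> (\<forall>x\<in>I. x - int n \<in> I \<and> x - int m \<in> I)}"

lemma mem_ideal:
  assumes "r < n"
  shows "k + int m * int r + int n * c \<in> ideal p k \<longleftrightarrow> c < int (p (Suc r))"
  using assms coordinates_unique by (fastforce simp: ideal_def)

lemma mem_ideal': "r < n \<Longrightarrow> x = k + int m * int r + int n * c \<Longrightarrow>
    x \<in> ideal p k \<longleftrightarrow> c < int (p (Suc r))"
  using mem_ideal by simp

section \<open>From diagrams to ideals\<close>

lemma diagrams_antimono:
  assumes "p \<in> diagrams n m" "1 \<le> i" "i \<le> j" "j \<le> n"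
  shows "p j \<le> p i"
  using assms(3,4)
proof (induction j rule: dec_induct)
  case (step j)
  then have "p (j + 1) \<le> p j" using assms(1,2) by (auto simp: diagrams_def)
  then show ?case using step by simp
qed simp

lemma diagrams_le: "p \<in> diagrams n m \<Longrightarrow> p i \<le> m"
  by (cases "i \<in> {1..n}") (auto simp: diagrams_def)

text \<open>Subtracting \<open>n\<close> moves one column to the left. Subtracting \<open>m\<close>
  moves from row \<open>r\<close> to the row \<open>r - 1\<close>, which is at least as
  long.\<close>

lemma ideal_in_ideals:
  assumes p: "p \<in> diagrams n m"
  shows "ideal p k \<in> ideals"
proof -
  \<comment> \<open>In row \<open>r = 0\<close> these are the positions in columns \<open>-1\<close>
    and \<open>m\<close>.\<close>
  have "k - int n \<in> ideal p k" "k + int n * int m \<notin> ideal p k"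
    using mem_ideal'[OF n_pos, of "k - int n" k "-1" p] diagrams_le[OF p, of 1]
      mem_ideal'[OF n_pos, of "k + int n * int m" k "int m" p] by auto
  moreover have "x - int n \<in> ideal p k \<and> x - int m \<in> ideal p k" if x: "x \<in> ideal p k" for x
  proof
    obtain r c where r: "r < n" and c: "c < int (p (Suc r))"
      and x: "x = k + int m * int r + int n * c" using x by (auto simp: ideal_def)
    show "x - int n \<in> ideal p k"
      using mem_ideal'[OF r, of "x - int n" k "c - 1" p] c x by (simp add: algebra_simps)
    show "x - int m \<in> ideal p k"
    proof (cases r)
      case 0
      \<comment> \<open>Row \<open>0\<close> wraps around to row \<open>n - 1\<close>, with the
        column lowered by \<open>m\<close>. Since no row is longer than \<open>m\<close>, the new
        position lies to the left of the rectangle.\<close>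
      have "x - int m = k + int m * int (n - 1) + int n * (c - int m)"
        using n_pos 0 x by (simp add: algebra_simps of_nat_diff)
      moreover have "c - int m < 0" using c diagrams_le[OF p, of "Suc r"] by simp
      ultimately show ?thesis using mem_ideal'[of "n - 1" "x - int m"] n_pos by fastforce
    next
      case (Suc s)
      have "p (Suc r) \<le> p (Suc s)" using diagrams_antimono[OF p, of "Suc s" "Suc r"] r Suc by simp
      then show ?thesis using mem_ideal'[of s "x - int m" k c p] r c x Suc
        by (simp add: algebra_simps)
    qed
  qed
  ultimately show ?thesis unfolding ideals_def by blast
qed

section \<open>Ideals along residue classes and differences of ideals\<close>

lemma ideals_diff:
  assumes I: "I \<in> ideals" "x \<in> I"
  shows "x - int n * int a - int m * int b \<in> I"
proof -
  have 1: "x - int n * int a \<in> I"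
  proof (induction a)
    case (Suc a)
    then have "x - int n * int a - int n \<in> I" using I(1) by (simp add: ideals_def)
    then show ?case by (simp add: algebra_simps)
  qed (use I in simp)
  show ?thesis
  proof (induction b)
    case (Suc b)
    then have "x - int n * int a - int m * int b - int m \<in> I" using I(1) by (simp add: ideals_def)
    then show ?case by (simp add: algebra_simps)
  qed (use 1 in simp)
qed

text \<open>Write \<open>x - y = m r + n c\<close> with \<open>r < n\<close>. As
  \<open>m r < n m\<close>, the bound forces \<open>c > 0\<close>, so \<open>y\<close> arises from
  \<open>x\<close> by subtracting copies of \<open>n\<close> and \<open>m\<close>.\<close>

lemma ideals_diff_large:
  assumes I: "I \<in> ideals" "x \<in> I" and y: "y \<le> x - int n * int m"
  shows "y \<in> I"
proof -
  obtain r c where r: "r < n" and c: "x = y + int m * int r + int n * c" by (rule coordinates)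
  have "int m * int r < int m * int n" using r m_pos by simp
  then have "int n * c > 0" using y c by (simp add: mult.commute)
  then have "c > 0" using n_pos by (simp add: zero_less_mult_iff)
  then show ?thesis using ideals_diff[OF I, of "nat c" r] c by simp
qed

text \<open>All sufficiently small integers lie in \<open>J\<close> and all sufficiently large ones
  outside \<open>I\<close>. Finiteness makes the symmetric difference usable as an induction
  measure.\<close>

lemma finite_ideals_diff:
  assumes "I \<in> ideals" "J \<in> ideals"
  shows "finite (I - J)"
proof -
  obtain y z where y: "y \<notin> I" and z: "z \<in> J" using assms by (auto simp: ideals_def)
  have "I - J \<subseteq> {z - int n * int m..y + int n * int m}"
  proof
    fix x assume x: "x \<in> I - J"
    then show "x \<in> {z - int n * int m..y + int n * int m}"
      using ideals_diff_large[OF assms(1), of x y] ideals_diff_large[OF assms(2) z, of x] y by fastforce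
  qed
  then show ?thesis using finite_subset by blast
qed

text \<open>On a residue class modulo \<open>n\<close> or \<open>m\<close> an ideal is a downward
  ray, and \<open>a\<close> is its first integer outside.\<close>

lemma ideals_less:
  assumes "I \<in> ideals" "d = n \<or> d = m" "a \<notin> I" "a - int d \<in> I" "int d dvd x - a"
  shows "x \<in> I \<longleftrightarrow> x < a"
proof -
  obtain t where t: "x - a = int d * t" using assms(5) by (rule dvdE)
  have step: "y - int d * int s \<in> I" if "y \<in> I" for y s
    using assms(2) ideals_diff[OF assms(1) that, of s 0] ideals_diff[OF assms(1) that, of 0 s] by auto
  have d: "int d > 0" using assms(2) n_pos m_pos by auto
  show ?thesis
  proof (cases "t \<ge> 0")
    case True
    then have "x \<notin> I" using step[of x "nat t"] t assms(3) by (auto simp: algebra_simps)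
    then show ?thesis using True t d by (smt (verit) zero_le_mult_iff)
  next
    case False
    then have "x \<in> I" using step[OF assms(4), of "nat (- t - 1)"] t by (simp add: algebra_simps)
    then show ?thesis using False t d by (smt (verit) mult_pos_neg)
  qed
qed

text \<open>The condition on \<open>k\<close> says that the lower left corner of the rectangle lies on the
  boundary path of \<open>I\<close>.\<close>

lemma ideal_surj_at:
  assumes I: "I \<in> ideals" and k: "k + int n * int m \<notin> I" "k + int n * int m - int n - int m \<in> I"
  obtains p where "p \<in> diagrams n m" "ideal p k = I"
proof -
  \<comment> \<open>The row length is the first nonnegative column outside \<open>I\<close>;
    \<open>top\<close> shows that column \<open>m\<close> is already outside.\<close>
  define g where "g r = (LEAST c. k + int m * int r + int n * int c \<notin> I)" for r
  define p where "p i = (if i \<in> {1..n} then g (i - 1) else 0)" for i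
  have top: "k + int m * int r + int n * int m \<notin> I" for r
    using ideals_diff[OF I, of "k + int m * int r + int n * int m" 0 r] k(1) by auto
  have g_notin: "k + int m * int r + int n * int (g r) \<notin> I" for r
    unfolding g_def using top by (rule LeastI)
  have g_in: "c < int (g r) \<longleftrightarrow> k + int m * int r + int n * c \<in> I" if r: "r < n" for r c
  proof (cases "c \<ge> 0")
    case True
    show ?thesis
    proof
      assume "c < int (g r)"
      then have "nat c < g r" using True by simp
      then show "k + int m * int r + int n * c \<in> I"
        unfolding g_def using not_less_Least True by fastforce
    next
      assume in_I: "k + int m * int r + int n * c \<in> I"
      show "c < int (g r)"
      proof (rule ccontr)
        assume "\<not> c < int (g r)"
        then show False
          using ideals_diff[OF I in_I, of "nat (c - int (g r))" 0] g_notin[of r]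
          by (simp add: algebra_simps)
      qed
    qed
  next
    case False
    \<comment> \<open>\<open>k + int n * int m - int n - int m\<close> is the position in row
      \<open>n - 1\<close>, column \<open>-1\<close>. Every position to the left of the rectangle
      lies below it by copies of \<open>n\<close> and \<open>m\<close>, hence in
      \<open>I\<close>.\<close>
    have "k + int n * int m - int n - int m - int n * int (nat (- c - 1)) - int m * int (n - 1 - r) \<in> I"
      by (rule ideals_diff[OF I k(2)])
    moreover have "k + int n * int m - int n - int m - int n * int (nat (- c - 1)) - int m * int (n - 1 - r)
       = k + int m * int r + int n * c"
      using r False by (simp add: algebra_simps of_nat_diff)
    ultimately have "k + int m * int r + int n * c \<in> I" by metis
    then show ?thesis using False by simp
  qed
  have "g r \<le> m" for r
    unfolding g_def using top by (rule Least_le)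
  moreover have "g (Suc r) \<le> g r" for r
  proof -
    have "k + int m * int (Suc r) + int n * int (g r) \<notin> I"
      using ideals_diff[OF I, of "k + int m * int (Suc r) + int n * int (g r)" 0 1] g_notin[of r]
      by (auto simp: algebra_simps)
    then show ?thesis unfolding g_def[of "Suc r"] by (rule Least_le)
  qed
  then have "g i \<le> g (i - 1)" if "i \<ge> 1" for i using that by (cases i) auto
  ultimately have "p \<in> diagrams n m" by (auto simp: diagrams_def p_def)
  moreover have "ideal p k = I"
  proof (rule set_eqI)
    fix x
    obtain r c where r: "r < n" and x: "x = k + int m * int r + int n * c" by (rule coordinates)
    then show "x \<in> ideal p k \<longleftrightarrow> x \<in> I"
      using mem_ideal[OF r, of k c p] g_in[OF r, of c] by (simp add: p_def)
  qed
  ultimately show ?thesis by (rule that)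
qed

text \<open>Go upwards in steps of \<open>n\<close> from an element of \<open>I\<close> to the first
  exit. The exit is outside \<open>I\<close>, and lowering it by \<open>n\<close> and then
  \<open>m\<close> leads back into \<open>I\<close>; lowering the exit by \<open>n m\<close>
  therefore gives an admissible offset.\<close>

lemma ideal_surj:
  assumes I: "I \<in> ideals"
  obtains p k where "p \<in> diagrams n m" "ideal p k = I"
proof -
  obtain y z where y: "y \<in> I" and z: "z \<notin> I" using I by (auto simp: ideals_def)
  define c where "c = (LEAST c. y + int n * int c \<notin> I)"
  \<comment> \<open>\<open>b\<close> serves only to show that the exit exists:
    \<open>y + n b\<close> is at least \<open>n m\<close> above \<open>z\<close>, so its membership
    would force \<open>z\<close> into \<open>I\<close>.\<close>
  define b where "b = nat (z + int n * int m - y)"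
  have "int n * int b \<ge> 1 * int b"
    using n_pos by (intro mult_right_mono) auto
  then have "z \<le> y + int n * int b - int n * int m" unfolding b_def by linarith
  then have "y + int n * int b \<notin> I" using ideals_diff_large[OF I] z by blast
  then have 1: "y + int n * int c \<notin> I" unfolding c_def by (rule LeastI)
  then obtain a where a: "c = Suc a" using y by (cases c) auto
  then have "a < (LEAST c. y + int n * int c \<notin> I)" unfolding c_def[symmetric] by simp
  then have "y + int n * int a \<in> I" using not_less_Least by blast
  then have "y + int n * int a - int m \<in> I" using I by (simp add: ideals_def)
  then have "y + int n * int c - int n - int m \<in> I" using a by (simp add: algebra_simps)
  then show ?thesis
    using ideal_surj_at[OF I, of "y + int n * int c - int n * int m"] 1 that by auto
qed

text \<open>Moving the offset by \<open>n t\<close> renumbers the columns by \<open>t\<close> and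
  keeps the rows.\<close>

lemma ideal_shift_eq:
  assumes "ideal p k = ideal q (k + int n * t)" and "r < n"
  shows "int (p (Suc r)) = int (q (Suc r)) + t"
proof -
  have "c < int (p (Suc r)) \<longleftrightarrow> c - t < int (q (Suc r))" for c
    using mem_ideal[OF assms(2), of k c p] assms(1)
      mem_ideal'[OF assms(2), of "k + int m * int r + int n * c" "k + int n * t" "c - t" q]
    by (simp add: algebra_simps)
  \<comment> \<open>The values of \<open>c\<close> on both sides of the end of the row pin down its
    length.\<close>
  from this[of "int (p (Suc r))"] this[of "int (p (Suc r)) - 1"] show ?thesis by simp
qed

lemma diagrams_eqI:
  assumes "p \<in> diagrams n m" "q \<in> diagrams n m" "\<And>r. r < n \<Longrightarrow> p (Suc r) = q (Suc r)"
  shows "p = q"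
proof
  fix i show "p i = q i"
    using assms by (cases "i \<in> {1..n}"; cases i) (auto simp: diagrams_def)
qed

lemma ideal_inj:
  assumes "p \<in> diagrams n m" "q \<in> diagrams n m" "ideal p k = ideal q k"
  shows "p = q"
  using diagrams_eqI[OF assms(1,2)] ideal_shift_eq[of p k q 0] assms(3) by simp

subsection \<open>Equivalence of pairs as equality of ideals\<close>

lemma remove_row_diagrams: "p \<in> diagrams n m \<Longrightarrow> remove_row n p \<in> diagrams n m"
  by (auto simp: remove_row_def diagrams_def)

lemma remove_col_diagrams: "p \<in> diagrams n m \<Longrightarrow> remove_col n p \<in> diagrams n m"
  by (force simp: remove_col_def diagrams_def intro: diff_le_mono order.trans[OF diff_le_self])

text \<open>Relative to the offset \<open>k + m\<close> every row index drops by one, and row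
  \<open>0\<close> becomes row \<open>n - 1\<close> with columns lowered by \<open>m\<close>. A row
  of length exactly \<open>m\<close> thus becomes an empty one.\<close>

lemma ideal_remove_row:
  assumes "p 1 = m"
  shows "ideal (remove_row n p) (k + int m) = ideal p k"
proof (rule set_eqI)
  fix x
  obtain r c where r: "r < n" and x: "x = k + int m * int r + int n * c" by (rule coordinates)
  show "x \<in> ideal (remove_row n p) (k + int m) \<longleftrightarrow> x \<in> ideal p k"
  proof (cases r)
    case 0
    have "x = (k + int m) + int m * int (n - 1) + int n * (c - int m)"
      using n_pos 0 x by (simp add: algebra_simps of_nat_diff)
    then have "x \<in> ideal (remove_row n p) (k + int m) \<longleftrightarrow> c - int m < 0"
      using mem_ideal'[of "n - 1" x "k + int m" "c - int m" "remove_row n p"] n_pos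
      by (simp add: remove_row_def)
    then show ?thesis using mem_ideal'[OF r x, of p] assms 0 by simp
  next
    case (Suc s)
    then show ?thesis
      using mem_ideal'[OF r x, of p] r x
        mem_ideal'[of s x "k + int m" c "remove_row n p"]
      by (simp add: remove_row_def algebra_simps)
  qed
qed

lemma dual_part_1: "dual_part n p 1 = n \<longleftrightarrow> (\<forall>i\<in>{1..n}. 1 \<le> p i)"
proof -
  have "dual_part n p 1 = n \<longleftrightarrow> {i \<in> {1..n}. 1 \<le> p i} = {1..n}"
    unfolding dual_part_def
    by (metis (no_types, lifting) card_atLeastAtMost card_subset_eq diff_Suc_1 finite_atLeastAtMost
        mem_Collect_eq subsetI)
  then show ?thesis by auto
qed

lemma ideal_remove_col:
  assumes "\<forall>i\<in>{1..n}. 1 \<le> p i"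
  shows "ideal (remove_col n p) (k + int n) = ideal p k"
proof (rule set_eqI)
  fix x
  obtain r c where r: "r < n" and x: "x = k + int m * int r + int n * c" by (rule coordinates)
  have "1 \<le> p (Suc r)" using assms r by simp
  then show "x \<in> ideal (remove_col n p) (k + int n) \<longleftrightarrow> x \<in> ideal p k"
    using mem_ideal'[OF r x, of p] r x
      mem_ideal'[of r x "k + int n" "c - 1" "remove_col n p"]
    by (simp add: remove_col_def algebra_simps)
qed

section \<open>The generated equivalence relation compared with equality of ideals\<close>

definition same_ideal :: "((part \<times> int) \<times> (part \<times> int)) set" where
  "same_ideal = {((p, k), (q, l)). p \<in> diagrams n m \<and> q \<in> diagrams n m \<and> ideal p k = ideal q l}"

lemma sim_gen_same_ideal: "sim_gen n m \<subseteq> same_ideal"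
  unfolding sim_gen_def same_ideal_def
  using remove_row_diagrams remove_col_diagrams ideal_remove_row ideal_remove_col dual_part_1 by auto

lemma equiv_same_ideal: "equiv (diagrams n m \<times> UNIV) same_ideal"
  by (rule equivI) (auto simp: same_ideal_def refl_on_def sym_def trans_def)

lemma equiv_sim: "equiv (diagrams n m \<times> UNIV) (sim n m)"
proof (rule equivI)
  show "sim n m \<subseteq> (diagrams n m \<times> UNIV) \<times> (diagrams n m \<times> UNIV)"
    \<comment> \<open>\<open>same_ideal\<close> is one of the intersected relations and so bounds
      the intersection.\<close>
    unfolding sim_def using equiv_same_ideal sim_gen_same_ideal by (auto simp: same_ideal_def)
  show "refl_on (diagrams n m \<times> UNIV) (sim n m)"
    by (auto simp: sim_def refl_on_def equiv_def)
  show "sym (sim n m)"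
    by (auto simp: sim_def sym_def equiv_def)
  show "trans (sim n m)"
    unfolding sim_def equiv_def by (rule transI) (auto dest: transD)
qed

lemma sim_gen_sim: "sim_gen n m \<subseteq> sim n m"
  by (auto simp: sim_def)

lemma sim_same_ideal: "sim n m \<subseteq> same_ideal"
  using equiv_same_ideal sim_gen_same_ideal by (auto simp: sim_def)

lemma sim_sym: "(x, y) \<in> sim n m \<Longrightarrow> (y, x) \<in> sim n m"
  using equiv_sim by (auto simp: equiv_def sym_def)

lemma sim_trans: "(x, y) \<in> sim n m \<Longrightarrow> (y, z) \<in> sim n m \<Longrightarrow> (x, z) \<in> sim n m"
  using equiv_sim by (meson equivE transD)

lemma sim_refl: "p \<in> diagrams n m \<Longrightarrow> ((p, k), (p, k)) \<in> sim n m"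
  using equiv_sim by (auto simp: equiv_def refl_on_def)

text \<open>As long as \<open>t > 0\<close>, every row of \<open>q\<close> is nonempty, so a full
  column can be removed.\<close>

lemma sim_remove_cols:
  assumes "p \<in> diagrams n m" "q \<in> diagrams n m" "\<And>r. r < n \<Longrightarrow> q (Suc r) = p (Suc r) + t"
  shows "((q, l), (p, l + int n * int t)) \<in> sim n m"
  using assms(2,3)
proof (induction t arbitrary: q l)
  case 0
  then have "q = p" using diagrams_eqI[OF _ assms(1)] by simp
  then show ?case using sim_refl assms(1) by simp
next
  case (Suc t)
  have "\<forall>i\<in>{1..n}. 1 \<le> q i"
  proof
    fix i assume "i \<in> {1..n}"
    then show "1 \<le> q i" using Suc.prems(2)[of "i - 1"] by auto
  qed
  then have "((q, l), (remove_col n q, l + int n)) \<in> sim n m"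
    using sim_gen_sim Suc.prems(1) dual_part_1 by (auto simp: sim_gen_def)
  moreover have "((remove_col n q, l + int n), (p, l + int n + int n * int t)) \<in> sim n m"
    using remove_col_diagrams[OF Suc.prems(1)] Suc.prems(2) by (intro Suc.IH) (auto simp: remove_col_def)
  ultimately show ?case by (auto intro: sim_trans simp: algebra_simps)
qed

text \<open>A row can be removed only when it has length \<open>m\<close>. So
  \<open>t = m - p 1\<close> full columns are first added, which is column removal read backwards,
  and then the row is removed.\<close>

lemma sim_next_row:
  assumes p: "p \<in> diagrams n m"
  obtains q c where "q \<in> diagrams n m" "((p, k), (q, k + int m + int n * c)) \<in> sim n m"
proof -
  define t where "t = m - p 1"
  define q where "q i = (if i \<in> {1..n} then p i + t else 0)" for i
  have t: "p 1 + t = m" using diagrams_le[OF p, of 1] by (simp add: t_def)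
  have "q \<in> diagrams n m"
    using diagrams_antimono[OF p, of 1] t p by (force simp: q_def diagrams_def)
  moreover have "q 1 = m" using t n_pos by (simp add: q_def)
  ultimately have "((q, k - int n * int t), (remove_row n q, k - int n * int t + int m)) \<in> sim n m"
    using sim_gen_sim by (auto simp: sim_gen_def)
  moreover have "((q, k - int n * int t), (p, k)) \<in> sim n m"
    using sim_remove_cols[OF p \<open>q \<in> diagrams n m\<close>, of t "k - int n * int t"] by (simp add: q_def)
  ultimately have "((p, k), (remove_row n q, k - int n * int t + int m)) \<in> sim n m"
    using sim_sym sim_trans by blast
  then show ?thesis
    using that[of "remove_row n q" "- int t"] remove_row_diagrams[OF \<open>q \<in> diagrams n m\<close>]
    by (simp add: algebra_simps)
qed

text \<open>Iterating the row move brings the offset into any residue class modulo \<open>n\<close>,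
  because \<open>m\<close> generates the residues.\<close>

lemma sim_rows:
  assumes p: "p \<in> diagrams n m"
  shows "\<exists>q c. q \<in> diagrams n m \<and> ((p, k), (q, k + int m * int r + int n * c)) \<in> sim n m"
proof (induction r)
  case 0
  then show ?case using sim_refl[OF p, of k] p by (intro exI[of _ p] exI[of _ 0]) auto
next
  case (Suc r)
  then obtain q c where q: "q \<in> diagrams n m" "((p, k), (q, k + int m * int r + int n * c)) \<in> sim n m"
    by blast
  obtain q' c' where q': "q' \<in> diagrams n m"
    "((q, k + int m * int r + int n * c), (q', k + int m * int r + int n * c + int m + int n * c')) \<in> sim n m"
    using sim_next_row[OF q(1)] by blast
  have "((p, k), (q', k + int m * int (Suc r) + int n * (c + c'))) \<in> sim n m"
    using sim_trans[OF q(2) q'(2)] by (simp add: algebra_simps)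
  then show ?case using q'(1) by blast
qed

text \<open>For the nontrivial inclusion, move \<open>(p, k)\<close> by \<open>sim\<close> to an
  offset congruent to \<open>l\<close> modulo \<open>n\<close>. The two diagrams with equal ideals
  then differ only by full columns.\<close>

lemma sim_eq: "sim n m = same_ideal"
proof
  show "same_ideal \<subseteq> sim n m"
  proof (clarsimp simp: same_ideal_def)
    fix p k q l assume p: "p \<in> diagrams n m" and q: "q \<in> diagrams n m" and eq: "ideal p k = ideal q l"
    obtain r c where "l = k + int m * int r + int n * c" by (rule coordinates)
    moreover obtain p' c' where p': "p' \<in> diagrams n m"
      "((p, k), (p', k + int m * int r + int n * c')) \<in> sim n m"
      using sim_rows[OF p] by blast
    moreover define k' where "k' = k + int m * int r + int n * c'"
    moreover define t where "t = c - c'"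
    ultimately have l: "l = k' + int n * t" and pp': "((p, k), (p', k')) \<in> sim n m"
      by (auto simp: algebra_simps)
    have "ideal p' k' = ideal q l"
      using pp' sim_same_ideal eq by (auto simp: same_ideal_def)
    then have sh: "int (p' (Suc r)) = int (q (Suc r)) + t" if "r < n" for r
      using ideal_shift_eq that l by simp
    have "((p', k'), (q, l)) \<in> sim n m"
    \<comment> \<open>The sign of \<open>t\<close> tells which diagram has the extra columns; in the
      second case the equivalence is obtained from \<open>q\<close> and reversed.\<close>
    proof (cases "t \<ge> 0")
      case True
      then have "p' (Suc r) = q (Suc r) + nat t" if "r < n" for r using sh[OF that] by simp
      from sim_remove_cols[OF q p'(1) this, of k'] show ?thesis using True l by simp
    next
      case False
      then have "q (Suc r) = p' (Suc r) + nat (- t)" if "r < n" for r using sh[OF that] by simp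
      from sim_remove_cols[OF p'(1) q this, of l] show ?thesis using False l by (simp add: sim_sym)
    qed
    then show "((p, k), (q, l)) \<in> sim n m" using pp' sim_trans by blast
  qed
qed (rule sim_same_ideal)

section \<open>Equivalence classes parametrised by ideals\<close>

definition class_of :: "int set \<Rightarrow> (part \<times> int) set" where
  "class_of I = {(p, k). p \<in> diagrams n m \<and> ideal p k = I}"

lemma cls_eq: "p \<in> diagrams n m \<Longrightarrow> cls n m p k = class_of (ideal p k)"
  by (auto simp: cls_def sim_eq same_ideal_def class_of_def)

lemma class_of_inj:
  assumes "I \<in> ideals" "class_of I = class_of J"
  shows "I = J"
proof -
  obtain p k where "p \<in> diagrams n m" "ideal p k = I" using ideal_surj[OF assms(1)] .
  then have "(p, k) \<in> class_of J" using assms(2) by (auto simp: class_of_def)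
  then show ?thesis using \<open>ideal p k = I\<close> by (simp add: class_of_def)
qed

lemma bij_class_of: "bij_betw class_of ideals (classes n m)"
proof (rule bij_betw_imageI)
  show "inj_on class_of ideals" by (intro inj_onI class_of_inj)
  have "classes n m = {cls n m p k | p k. p \<in> diagrams n m}"
    by (auto simp: classes_def quotient_def cls_def)
  also have "\<dots> = {class_of (ideal p k) | p k. p \<in> diagrams n m}"
    using cls_eq by (metis (no_types))
  also have "\<dots> = class_of ` ideals"
    using ideal_in_ideals by (auto elim!: ideal_surj)
  finally show "class_of ` ideals = classes n m" by simp
qed

subsection \<open>The border of an ideal\<close>

definition translate :: "int \<Rightarrow> int set \<Rightarrow> int set" where
  "translate c I = {x. x - c \<in> I}"

lemma mem_translate [simp]: "x \<in> translate c I \<longleftrightarrow> x - c \<in> I"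
  by (simp add: translate_def)

lemma translate_translate [simp]: "translate a (translate b I) = translate (a + b) I"
  by (simp add: set_eq_iff diff_diff_eq)

lemma translate_0 [simp]: "translate 0 I = I"
  by (simp add: set_eq_iff)

lemma translate_ideal: "translate c (ideal p k) = ideal p (k + c)"
proof (rule set_eqI)
  fix x
  obtain r a where r: "r < n" and x: "x = k + c + int m * int r + int n * a" by (rule coordinates)
  show "x \<in> translate c (ideal p k) \<longleftrightarrow> x \<in> ideal p (k + c)"
    using mem_ideal'[OF r, of "x - c" k a p] mem_ideal'[OF r x, of p] x by simp
qed

section \<open>Rotations of vectors against translations of ideals\<close>

lemma const_vec_add [simp]: "const_vec n m a + const_vec n m b = const_vec n m (a + b)"
  by (auto simp: const_vec_def fun_eq_iff)

lemma const_vec_0 [simp]: "\<Lambda> + const_vec n m 0 = \<Lambda>"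
  by (auto simp: const_vec_def fun_eq_iff prod_eq_iff)

lemma nu_add_const: "nu n (\<Lambda> + const_vec n m c) = nu n \<Lambda> + const_vec n m c"
  by (auto simp: nu_def const_vec_def fun_eq_iff)

lemma eta_add_const: "eta m (\<Lambda> + const_vec n m c) = eta m \<Lambda> + const_vec n m c"
  by (auto simp: eta_def const_vec_def fun_eq_iff)

lemma lattice_nu: "nu n \<Lambda> + const_vec n m c \<in> lattice n m \<longleftrightarrow> \<Lambda> \<in> lattice n m"
  by (cases \<Lambda>) (auto simp: nu_def lattice_def const_vec_def)

lemma lattice_eta: "eta m \<Lambda> + const_vec n m c \<in> lattice n m \<longleftrightarrow> \<Lambda> \<in> lattice n m"
  by (cases \<Lambda>) (auto simp: eta_def lattice_def const_vec_def)

text \<open>At the wrap-around the two sides differ by \<open>m n\<close>, which is invisible modulo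
  \<open>n\<close>.\<close>

lemma dvd_cyc_pred:
  assumes "i \<in> {1..n}"
  shows "int n dvd y - int m + int m * int i \<longleftrightarrow> int n dvd y + int m * int (cyc_pred n i)"
  using assms by (auto simp: cyc_pred_def of_nat_diff algebra_simps)

lemma dvd_cyc_succ:
  assumes "j \<in> {1..m}"
  shows "int m dvd y - int n - int n * (int j - 1) \<longleftrightarrow>
         int m dvd y - int n * (int (cyc_succ m j) - 1)"
proof (cases "j = m")
  case True
  have "y - int n - int n * (int m - 1) = y + (- int n) * int m" by (simp add: algebra_simps)
  then show ?thesis using assms True
    by (simp only: dvd_add_times_triv_right_iff) (simp add: cyc_succ_def)
next
  case False
  then show ?thesis using assms by (auto simp: cyc_succ_def algebra_simps)
qed

text \<open>\<open>border I \<Lambda>\<close> says that \<open>a\<^sub>i\<close> and \<open>b\<^sub>j\<close> are the least integers outside \<open>I\<close> in the residue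
  classes of \<open>- m i\<close> modulo \<open>n\<close> and of \<open>n (j - 1)\<close> modulo \<open>m\<close>.\<close>

definition border :: "int set \<Rightarrow> svec \<Rightarrow> bool" where
  "border I \<Lambda> \<longleftrightarrow> \<Lambda> \<in> lattice n m \<and>
     (\<forall>i\<in>{1..n}. int n dvd fst \<Lambda> i + int m * int i \<and> fst \<Lambda> i \<notin> I \<and> fst \<Lambda> i - int n \<in> I) \<and>
     (\<forall>j\<in>{1..m}. int m dvd snd \<Lambda> j - int n * (int j - 1) \<and> snd \<Lambda> j \<notin> I \<and> snd \<Lambda> j - int m \<in> I)"

lemma border_row:
  assumes "border I \<Lambda>" "i \<in> {1..n}"
  shows "int n dvd fst \<Lambda> i + int m * int i" "fst \<Lambda> i \<notin> I" "fst \<Lambda> i - int n \<in> I"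
  using assms by (simp_all add: border_def)

lemma border_col:
  assumes "border I \<Lambda>" "j \<in> {1..m}"
  shows "int m dvd snd \<Lambda> j - int n * (int j - 1)" "snd \<Lambda> j \<notin> I" "snd \<Lambda> j - int m \<in> I"
  using assms by (simp_all add: border_def)

text \<open>Translation by \<open>- m\<close> lowers all entries by \<open>m\<close>. It carries the
  residue class \<open>- m i\<close> modulo \<open>n\<close> to that of \<open>i + 1\<close>, which
  is the relabelling done by \<open>nu\<close>, and it fixes the classes modulo
  \<open>m\<close>.\<close>

lemma border_nu:
  "border (translate (- int m) I) (nu n \<Lambda> + const_vec n m (- int m)) \<longleftrightarrow> border I \<Lambda>"
proof -
  define \<Theta> where "\<Theta> = nu n \<Lambda> + const_vec n m (- int m)"
  have a: "fst \<Theta> i = fst \<Lambda> (cyc_pred n i) - int m" if "i \<in> {1..n}" for i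
    using that by (simp add: \<Theta>_def nu_eq const_vec_def)
  have b: "snd \<Theta> j = snd \<Lambda> j - int m" if "j \<in> {1..m}" for j
    using that by (simp add: \<Theta>_def nu_eq const_vec_def)
  have "(\<forall>i\<in>{1..n}. int n dvd fst \<Theta> i + int m * int i \<and> fst \<Theta> i + int m \<notin> I \<and> fst \<Theta> i - int n + int m \<in> I)
    \<longleftrightarrow> (\<forall>i\<in>{1..n}. int n dvd fst \<Lambda> (cyc_pred n i) + int m * int (cyc_pred n i) \<and>
          fst \<Lambda> (cyc_pred n i) \<notin> I \<and> fst \<Lambda> (cyc_pred n i) - int n \<in> I)"
    by (rule ball_cong[OF refl]) (simp add: a dvd_cyc_pred del: atLeastAtMost_iff One_nat_def)
  also have "\<dots> \<longleftrightarrow> (\<forall>i\<in>{1..n}. int n dvd fst \<Lambda> i + int m * int i \<and> fst \<Lambda> i \<notin> I \<and> fst \<Lambda> i - int n \<in> I)"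
    by (rule ball_cyc_pred)
  finally have A: "(\<forall>i\<in>{1..n}. int n dvd fst \<Theta> i + int m * int i \<and> fst \<Theta> i + int m \<notin> I \<and> fst \<Theta> i - int n + int m \<in> I)
    \<longleftrightarrow> (\<forall>i\<in>{1..n}. int n dvd fst \<Lambda> i + int m * int i \<and> fst \<Lambda> i \<notin> I \<and> fst \<Lambda> i - int n \<in> I)" .
  have "int m dvd x - int m - y \<longleftrightarrow> int m dvd x - y" for x y
    by (smt (verit) dvd_add_triv_right_iff)
  then have B: "(\<forall>j\<in>{1..m}. int m dvd snd \<Theta> j - int n * (int j - 1) \<and> snd \<Theta> j + int m \<notin> I \<and> snd \<Theta> j - int m + int m \<in> I)
    \<longleftrightarrow> (\<forall>j\<in>{1..m}. int m dvd snd \<Lambda> j - int n * (int j - 1) \<and> snd \<Lambda> j \<notin> I \<and> snd \<Lambda> j - int m \<in> I)"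
    by (intro ball_cong[OF refl]) (simp add: b del: atLeastAtMost_iff One_nat_def)
  show ?thesis
    unfolding border_def \<Theta>_def[symmetric] mem_translate diff_minus_eq_add A B
    by (simp add: \<Theta>_def lattice_nu)
qed

text \<open>Translation by \<open>- n\<close> carries the class \<open>n (j - 1)\<close> modulo
  \<open>m\<close> to that of \<open>j - 1\<close>, as \<open>eta\<close> does, and fixes the
  classes modulo \<open>n\<close>.\<close>

lemma border_eta:
  "border (translate (- int n) I) (eta m \<Lambda> + const_vec n m (- int n)) \<longleftrightarrow> border I \<Lambda>"
proof -
  define \<Theta> where "\<Theta> = eta m \<Lambda> + const_vec n m (- int n)"
  have a: "fst \<Theta> i = fst \<Lambda> i - int n" if "i \<in> {1..n}" for i
    using that by (simp add: \<Theta>_def eta_eq const_vec_def)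
  have b: "snd \<Theta> j = snd \<Lambda> (cyc_succ m j) - int n" if "j \<in> {1..m}" for j
    using that by (simp add: \<Theta>_def eta_eq const_vec_def)
  have "(\<forall>j\<in>{1..m}. int m dvd snd \<Theta> j - int n * (int j - 1) \<and> snd \<Theta> j + int n \<notin> I \<and> snd \<Theta> j - int m + int n \<in> I)
    \<longleftrightarrow> (\<forall>j\<in>{1..m}. int m dvd snd \<Lambda> (cyc_succ m j) - int n * (int (cyc_succ m j) - 1) \<and>
          snd \<Lambda> (cyc_succ m j) \<notin> I \<and> snd \<Lambda> (cyc_succ m j) - int m \<in> I)"
    by (rule ball_cong[OF refl]) (simp add: b dvd_cyc_succ del: atLeastAtMost_iff One_nat_def)
  also have "\<dots> \<longleftrightarrow> (\<forall>j\<in>{1..m}. int m dvd snd \<Lambda> j - int n * (int j - 1) \<and> snd \<Lambda> j \<notin> I \<and> snd \<Lambda> j - int m \<in> I)"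
    by (rule ball_cyc_succ)
  finally have B: "(\<forall>j\<in>{1..m}. int m dvd snd \<Theta> j - int n * (int j - 1) \<and> snd \<Theta> j + int n \<notin> I \<and> snd \<Theta> j - int m + int n \<in> I)
    \<longleftrightarrow> (\<forall>j\<in>{1..m}. int m dvd snd \<Lambda> j - int n * (int j - 1) \<and> snd \<Lambda> j \<notin> I \<and> snd \<Lambda> j - int m \<in> I)" .
  have "int n dvd x - int n + y \<longleftrightarrow> int n dvd x + y" for x y
    by (smt (verit) dvd_add_triv_right_iff)
  then have A: "(\<forall>i\<in>{1..n}. int n dvd fst \<Theta> i + int m * int i \<and> fst \<Theta> i + int n \<notin> I \<and> fst \<Theta> i - int n + int n \<in> I)
    \<longleftrightarrow> (\<forall>i\<in>{1..n}. int n dvd fst \<Lambda> i + int m * int i \<and> fst \<Lambda> i \<notin> I \<and> fst \<Lambda> i - int n \<in> I)"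
    by (intro ball_cong[OF refl]) (simp add: a del: atLeastAtMost_iff One_nat_def)
  show ?thesis
    unfolding border_def \<Theta>_def[symmetric] mem_translate diff_minus_eq_add A B
    by (simp add: \<Theta>_def lattice_eta)
qed

lemma border_nu_pow:
  "border (translate (- (k * int m)) I) (int_pow (nu n) k \<Lambda> + const_vec n m (- (k * int m))) \<longleftrightarrow>
   border I \<Lambda>"
proof -
  have "border (translate (- ((k + 1) * int m)) I) (nu n \<Theta> + const_vec n m (- ((k + 1) * int m))) \<longleftrightarrow>
    border (translate (- (k * int m)) I) (\<Theta> + const_vec n m (- (k * int m)))" for k \<Theta>
    using border_nu[of "translate (- (k * int m)) I" "\<Theta> + const_vec n m (- (k * int m))"]
    by (simp add: nu_add_const add.assoc algebra_simps)
  from int_pow_invariant[where P = "\<lambda>k \<Theta>. border (translate (- (k * int m)) I) (\<Theta> + const_vec n m (- (k * int m)))",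
      OF bij_nu this]
  show ?thesis by simp
qed

text \<open>The constant \<open>d\<close> carries the shift left by the powers of \<open>nu\<close>,
  since all constants are collected after both rotations.\<close>

lemma border_eta_pow:
  "border (translate (- (k * int n)) I) (int_pow (eta m) k \<Lambda> + const_vec n m (d - k * int n)) \<longleftrightarrow>
   border I (\<Lambda> + const_vec n m d)"
proof -
  have "border (translate (- ((k + 1) * int n)) I) (eta m \<Theta> + const_vec n m (d - (k + 1) * int n)) \<longleftrightarrow>
    border (translate (- (k * int n)) I) (\<Theta> + const_vec n m (d - k * int n))" for k \<Theta>
    using border_eta[of "translate (- (k * int n)) I" "\<Theta> + const_vec n m (d - k * int n)"]
    by (simp add: eta_add_const add.assoc algebra_simps)
  from int_pow_invariant[where P = "\<lambda>k \<Theta>. border (translate (- (k * int n)) I) (\<Theta> + const_vec n m (d - k * int n))",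
      OF bij_eta this]
  show ?thesis by simp
qed

text \<open>Explains the formula for \<open>xhat\<close>: changing the offset from \<open>0\<close>
  to \<open>i n + j m\<close> translates the ideal, and the border follows by rotations and constant
  vectors.\<close>

lemma border_rot:
  "border (translate (i * int n + j * int m) I)
     (int_pow (eta m) (- i) (int_pow (nu n) (- j) \<Lambda>) + const_vec n m (i * int n) + const_vec n m (j * int m))
   \<longleftrightarrow> border I \<Lambda>"
  using border_nu_pow[of "- j" I \<Lambda>]
    border_eta_pow[of "- i" "translate (j * int m) I" "int_pow (nu n) (- j) \<Lambda>" "j * int m"]
  by (simp add: add.assoc add.commute[of "j * int m"])

section \<open>Borders and ideals determine each other\<close>

lemma step_unique:
  assumes "I \<in> ideals" "d = n \<or> d = m" "x \<notin> I" "x - int d \<in> I" "y \<notin> I" "y - int d \<in> I"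
    and "int d dvd x - y"
  shows "x = y"
proof -
  have "int d dvd y - x" using assms(7) by (simp add: dvd_diff_commute)
  then show ?thesis
    using ideals_less[OF assms(1,2,3,4)] ideals_less[OF assms(1,2,5,6,7)] assms(3,5) by force
qed

lemma dvd_diff_cancel:
  "(d::int) dvd x + z \<Longrightarrow> d dvd y + z \<Longrightarrow> d dvd x - y" "d dvd x - z \<Longrightarrow> d dvd y - z \<Longrightarrow> d dvd x - y"
  using dvd_diff[of d "x + z" "y + z"] dvd_diff[of d "x - z" "y - z"] by simp_all

lemma border_unique:
  assumes I: "I \<in> ideals" and b: "border I \<Lambda>" "border I \<Theta>"
  shows "\<Lambda> = \<Theta>"
proof -
  have "fst \<Lambda> i = fst \<Theta> i" for i
  proof (cases "i \<in> {1..n}")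
    case True
    note 1 = border_row[OF b(1) this] and 2 = border_row[OF b(2) this]
    show ?thesis
      using step_unique[OF I _ 1(2,3) 2(2,3) dvd_diff_cancel(1)[OF 1(1) 2(1)]] by simp
  qed (use b in \<open>auto simp: border_def lattice_def\<close>)
  moreover have "snd \<Lambda> j = snd \<Theta> j" for j
  proof (cases "j \<in> {1..m}")
    case True
    note 1 = border_col[OF b(1) this] and 2 = border_col[OF b(2) this]
    show ?thesis
      using step_unique[OF I _ 1(2,3) 2(2,3) dvd_diff_cancel(2)[OF 1(1) 2(1)]] by simp
  qed (use b in \<open>auto simp: border_def lattice_def\<close>)
  ultimately show ?thesis by (simp add: prod_eq_iff fun_eq_iff)
qed

lemma row_residue: obtains i where "i \<in> {1..n}" "int n dvd x + int m * int i"
proof -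
  obtain r c where r: "r < n" and x: "x = 0 + int m * int r + int n * c" by (rule coordinates)
  have "x + int m * int (n - r) = int n * (c + int m)"
    using r x by (simp add: of_nat_diff algebra_simps)
  then have "int n dvd x + int m * int (n - r)" by simp
  then show ?thesis using that[of "n - r"] r by auto
qed

lemma col_residue: obtains j where "j \<in> {1..m}" "int m dvd x - int n * (int j - 1)"
proof -
  \<comment> \<open>Columns are handled by the coordinates with \<open>n\<close> and
    \<open>m\<close> exchanged.\<close>
  interpret swap: coprime_pair m n
    using n_pos m_pos coprime_nm by unfold_locales (auto simp: coprime_commute)
  obtain r c where r: "r < m" and x: "x = 0 + int n * int r + int m * c" by (rule swap.coordinates)
  then have "int m dvd x - int n * (int (Suc r) - 1)" by simp
  then show ?thesis using that[of "Suc r"] r by auto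
qed

text \<open>The row entries alone suffice: every integer lies in the residue class of some row,
  where membership means being below the entry.\<close>

lemma border_inj:
  assumes I: "I \<in> ideals" "J \<in> ideals" and b: "border I \<Lambda>" "border J \<Lambda>"
  shows "I = J"
proof (rule set_eqI)
  fix x
  obtain i where i: "i \<in> {1..n}" "int n dvd x + int m * int i" by (rule row_residue)
  have "int n dvd x - fst \<Lambda> i" using b(1) i by (auto simp: border_def intro: dvd_diff_cancel)
  then show "x \<in> I \<longleftrightarrow> x \<in> J"
    using ideals_less[OF I(1), of n "fst \<Lambda> i" x] ideals_less[OF I(2), of n "fst \<Lambda> i" x] b i(1)
    by (auto simp: border_def)
qed

text \<open>The rows counted by \<open>dual_part\<close> form an initial segment, because the parts
  decrease weakly.\<close>

lemma le_dual_part: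
  assumes p: "p \<in> diagrams n m" and i: "i \<in> {1..n}"
  shows "i \<le> dual_part n p j \<longleftrightarrow> j \<le> p i"
proof
  assume "j \<le> p i"
  then have "{1..i} \<subseteq> {i \<in> {1..n}. j \<le> p i}"
    using diagrams_antimono[OF p] i by (force intro: order.trans)
  then have "card {1..i} \<le> dual_part n p j" unfolding dual_part_def by (intro card_mono) auto
  then show "i \<le> dual_part n p j" by simp
next
  assume le: "i \<le> dual_part n p j"
  show "j \<le> p i"
  proof (rule ccontr)
    assume n: "\<not> j \<le> p i"
    have "{i \<in> {1..n}. j \<le> p i} \<subseteq> {1..<i}"
    proof
      fix l assume l: "l \<in> {i \<in> {1..n}. j \<le> p i}"
      then show "l \<in> {1..<i}"
        using diagrams_antimono[OF p, of i l] i n by (cases "l < i") auto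
    qed
    then have "dual_part n p j \<le> card {1..<i}" unfolding dual_part_def by (intro card_mono) auto
    then show False using le i by auto
  qed
qed

lemma dual_part_le: "dual_part n p j \<le> n"
proof -
  have "dual_part n p j \<le> card {1..n}" unfolding dual_part_def by (intro card_mono) auto
  then show ?thesis by simp
qed

text \<open>\<open>a_i\<close> is the first position beyond the end of a row, and \<open>b_j\<close>
  the first position beyond the end of a column of height \<open>s\<close>, that is, row
  \<open>s\<close> in column \<open>j - 1\<close>.\<close>

lemma border_x_vec:
  assumes p: "p \<in> diagrams n m"
  shows "border (ideal p 0) (x_vec n m p)"
  unfolding border_def
proof (intro conjI ballI)
  show "x_vec n m p \<in> lattice n m" by (auto simp: x_vec_def lattice_def)
next
  fix i assume i: "i \<in> {1..n}"
  define a where "a = fst (x_vec n m p) i"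
  have a: "a = 0 + int m * int (n - i) + int n * int (p (Suc (n - i)))"
    using i by (simp add: a_def x_vec_def of_nat_diff Suc_diff_le)
  then have "a + int m * int i = int n * (int m + int (p (Suc (n - i))))"
    using i by (simp add: of_nat_diff algebra_simps)
  then show "int n dvd fst (x_vec n m p) i + int m * int i" by (simp add: a_def)
  have r: "n - i < n" using i by auto
  show "fst (x_vec n m p) i \<notin> ideal p 0"
    using mem_ideal'[OF r a, of p] by (simp add: a_def)
  show "fst (x_vec n m p) i - int n \<in> ideal p 0"
    using mem_ideal'[OF r, of "a - int n" 0 "int (p (Suc (n - i))) - 1" p] a
    by (simp add: a_def algebra_simps)
next
  fix j assume j: "j \<in> {1..m}"
  define s where "s = dual_part n p j"
  define b where "b = snd (x_vec n m p) j"
  have b: "b = int n * (int j - 1) + int m * int s"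
    using j by (simp add: b_def x_vec_def s_def)
  show "int m dvd snd (x_vec n m p) j - int n * (int j - 1)"
    using b by (simp add: b_def[symmetric])
  have "b \<notin> ideal p 0"
  proof (cases "s < n")
    case True
    have "\<not> j \<le> p (Suc s)" using le_dual_part[OF p, of "Suc s" j] True by (simp add: s_def)
    then show ?thesis using mem_ideal'[OF True, of b 0 "int j - 1" p] b by simp
  next
    case False
    then have "s = n" using dual_part_le[of p j] by (simp add: s_def)
    \<comment> \<open>A full column ends in row \<open>n\<close>, which is row \<open>0\<close> with
      the column raised by \<open>m\<close>, beyond the rectangle.\<close>
    then have "b = 0 + int m * int 0 + int n * (int j - 1 + int m)" using b by (simp add: algebra_simps)
    from mem_ideal'[OF n_pos this, of p] show ?thesis using diagrams_le[OF p, of 1] j by auto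
  qed
  then show "snd (x_vec n m p) j \<notin> ideal p 0" by (simp add: b_def)
  have "b - int m \<in> ideal p 0"
  proof (cases s)
    case 0
    \<comment> \<open>Below an empty column comes row \<open>-1\<close>, which is row
      \<open>n - 1\<close> with the column lowered by \<open>m\<close>, left of the
      rectangle.\<close>
    have "b - int m = 0 + int m * int (n - 1) + int n * (int j - 1 - int m)"
      using n_pos 0 b by (simp add: of_nat_diff algebra_simps)
    from mem_ideal'[OF _ this, of p] show ?thesis using n_pos j by auto
  next
    case (Suc t)
    then have t: "t < n" using dual_part_le[of p j] by (simp add: s_def)
    then have "j \<le> p (Suc t)" using le_dual_part[OF p, of "Suc t" j] Suc by (simp add: s_def)
    moreover have "b - int m = 0 + int m * int t + int n * (int j - 1)"
      using b Suc by (simp add: algebra_simps)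
    ultimately show ?thesis using mem_ideal'[OF t, of "b - int m" 0 "int j - 1" p] by simp
  qed
  then show "snd (x_vec n m p) j - int m \<in> ideal p 0" by (simp add: b_def)
qed

text \<open>Each representative yields a border of \<open>I\<close>, and borders are unique; hence
  the description by \<open>THE\<close> is well defined.\<close>

lemma border_xhat:
  assumes I: "I \<in> ideals"
  shows "border I (xhat n m (class_of I))"
proof -
  let ?x = "\<lambda>p i j. int_pow (eta m) (- i) (int_pow (nu n) (- j) (x_vec n m p))
            + const_vec n m (i * int n) + const_vec n m (j * int m)"
  have b: "border I (?x p i j)" if "(p, i * int n + j * int m) \<in> class_of I" for p i j
  proof -
    have p: "p \<in> diagrams n m" "ideal p (i * int n + j * int m) = I"
      using that by (auto simp: class_of_def)
    show ?thesis
      using border_rot[of i j "ideal p 0" "x_vec n m p"] border_x_vec[OF p(1)] p(2)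
      by (simp add: translate_ideal)
  qed
  obtain p k where p: "p \<in> diagrams n m" "ideal p k = I" using ideal_surj[OF I] .
  obtain i j where k: "k = i * int n + j * int m" by (rule bezout)
  have mem: "(p, i * int n + j * int m) \<in> class_of I" using p k by (simp add: class_of_def)
  have "xhat n m (class_of I) = ?x p i j"
    unfolding xhat_def
  proof (rule the_equality)
    show "\<exists>q i' j'. (q, i' * int n + j' * int m) \<in> class_of I \<and> ?x p i j = ?x q i' j'"
      using mem by blast
    show "\<Lambda> = ?x p i j" if "\<exists>q i' j'. (q, i' * int n + j' * int m) \<in> class_of I \<and> \<Lambda> = ?x q i' j'" for \<Lambda>
      using that b[OF mem] b border_unique[OF I] by blast
  qed
  then show ?thesis using b[OF mem] by simp
qed

subsection \<open>Corners\<close>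

fun positive :: "iso_root \<Rightarrow> bool" where
  "positive (eps_delta i j) \<longleftrightarrow> True"
| "positive (delta_eps i j) \<longleftrightarrow> False"

text \<open>The residues of \<open>x\<close> name a row and a column, the same for a root and its
  negative; the sign is kept separately in \<open>positive\<close>.\<close>

fun content :: "iso_root \<Rightarrow> int \<Rightarrow> bool" where
  "content (eps_delta i j) x \<longleftrightarrow> int n dvd x + int m * int i \<and> int m dvd x - int n * (int j - 1)"
| "content (delta_eps i j) x \<longleftrightarrow> int n dvd x + int m * int i \<and> int m dvd x - int n * (int j - 1)"

definition corner :: "iso_root \<Rightarrow> int set \<Rightarrow> int \<Rightarrow> bool" where
  "corner \<alpha> I x \<longleftrightarrow> \<alpha> \<in> Delta_iso n m \<and> content \<alpha> x \<and>
     (if positive \<alpha> then x \<notin> I \<and> x - int n \<in> I \<and> x - int m \<in> I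
      else x \<in> I \<and> x + int n \<notin> I \<and> x + int m \<notin> I)"

lemma positive_neg_root [simp]: "positive (neg_root \<alpha>) \<longleftrightarrow> \<not> positive \<alpha>"
  by (cases \<alpha>) auto

lemma content_neg_root [simp]: "content (neg_root \<alpha>) x \<longleftrightarrow> content \<alpha> x"
  by (cases \<alpha>) auto

lemma positive_nu_root [simp]: "positive (nu_root n \<alpha>) \<longleftrightarrow> positive \<alpha>"
  by (cases \<alpha>) auto

lemma positive_eta_root [simp]: "positive (eta_root m \<alpha>) \<longleftrightarrow> positive \<alpha>"
  by (cases \<alpha>) auto

lemma content_nu_root:
  assumes "\<alpha> \<in> Delta_iso n m"
  shows "content (nu_root n \<alpha>) (x - int m) \<longleftrightarrow> content \<alpha> x"
proof -
  have 1: "int n dvd x - int m + int m * int (cyc_succ n i) \<longleftrightarrow> int n dvd x + int m * int i"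
    if "i \<in> {1..n}" for i
    using dvd_cyc_pred[of "cyc_succ n i" x] that by (simp del: atLeastAtMost_iff One_nat_def)
  have 2: "int m dvd x - int m - y \<longleftrightarrow> int m dvd x - y" for y
    by (smt (verit) dvd_add_triv_right_iff)
  show ?thesis using assms by (cases \<alpha>) (simp_all add: 1 2 del: atLeastAtMost_iff One_nat_def)
qed

lemma content_eta_root:
  assumes "\<alpha> \<in> Delta_iso n m"
  shows "content (eta_root m \<alpha>) (x - int n) \<longleftrightarrow> content \<alpha> x"
proof -
  have 1: "int m dvd x - int n - int n * (int (cyc_pred m j) - 1) \<longleftrightarrow> int m dvd x - int n * (int j - 1)"
    if "j \<in> {1..m}" for j
    using dvd_cyc_succ[of "cyc_pred m j" x] that by (simp del: atLeastAtMost_iff One_nat_def)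
  have 2: "int n dvd x - int n + y \<longleftrightarrow> int n dvd x + y" for y
    by (smt (verit) dvd_add_triv_right_iff)
  show ?thesis using assms by (cases \<alpha>) (simp_all add: 1 2 del: atLeastAtMost_iff One_nat_def)
qed

lemma corner_nu:
  "corner (nu_root n \<alpha>) (translate (c - int m) I) (x - int m) \<longleftrightarrow> corner \<alpha> (translate c I) x"
  using content_nu_root[of \<alpha> x] nu_root_Delta_iso[of n \<alpha> m] by (auto simp: corner_def algebra_simps)

lemma corner_eta:
  "corner (eta_root m \<alpha>) (translate (c - int n) I) (x - int n) \<longleftrightarrow> corner \<alpha> (translate c I) x"
  using content_eta_root[of \<alpha> x] eta_root_Delta_iso[of m \<alpha> n] by (auto simp: corner_def algebra_simps)

text \<open>Translating an ideal back to offset \<open>0\<close> changes the residues of its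
  corners, and \<open>rot_root\<close> is exactly the matching change of root.\<close>

lemma corner_rot_root:
  "corner (rot_root n m i j \<alpha>) (translate (- (i * int n + j * int m)) I) (x - (i * int n + j * int m))
   \<longleftrightarrow> corner \<alpha> I x"
proof -
  have 1: "corner (nu_root n \<beta>) (translate (- ((k + 1) * int m)) I) (x - (k + 1) * int m) \<longleftrightarrow>
    corner \<beta> (translate (- (k * int m)) I) (x - k * int m)" for k \<beta>
  proof -
    have "- ((k + 1) * int m) = - (k * int m) - int m" "x - (k + 1) * int m = x - k * int m - int m"
      by (simp_all add: algebra_simps)
    then show ?thesis by (simp only: corner_nu)
  qed
  have 2: "corner (eta_root m \<beta>) (translate (- ((k + 1) * int n + j * int m)) I) (x - ((k + 1) * int n + j * int m)) \<longleftrightarrow>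
    corner \<beta> (translate (- (k * int n + j * int m)) I) (x - (k * int n + j * int m))" for k \<beta>
  proof -
    have "- ((k + 1) * int n + j * int m) = - (k * int n + j * int m) - int n"
      "x - ((k + 1) * int n + j * int m) = x - (k * int n + j * int m) - int n"
      by (simp_all add: algebra_simps)
    then show ?thesis by (simp only: corner_eta)
  qed
  show ?thesis
    using int_pow_invariant[where P = "\<lambda>k \<beta>. corner \<beta> (translate (- (k * int m)) I) (x - k * int m)"
        and k = j and x = \<alpha>, OF bij_nu_root 1]
      int_pow_invariant[where P = "\<lambda>k \<beta>. corner \<beta> (translate (- (k * int n + j * int m)) I) (x - (k * int n + j * int m))"
        and k = i and x = "int_pow (nu_root n) j \<alpha>", OF bij_eta_root 2]
    by (simp add: rot_root_def)
qed

lemma positive_rot_root: "positive (rot_root n m i j \<alpha>) \<longleftrightarrow> positive \<alpha>"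
  using int_pow_invariant[where P = "\<lambda>_. positive", OF bij_nu_root, of n j \<alpha>]
    int_pow_invariant[where P = "\<lambda>_. positive", OF bij_eta_root, of m i "int_pow (nu_root n) j \<alpha>"]
  by (simp add: rot_root_def)

lemma rot_root_Delta_iso: "rot_root n m i j \<alpha> \<in> Delta_iso n m \<longleftrightarrow> \<alpha> \<in> Delta_iso n m"
  using int_pow_invariant[where P = "\<lambda>_ \<beta>. \<beta> \<in> Delta_iso n m", OF bij_nu_root, of n j \<alpha>]
    int_pow_invariant[where P = "\<lambda>_ \<beta>. \<beta> \<in> Delta_iso n m", OF bij_eta_root, of m i "int_pow (nu_root n) j \<alpha>"]
  by (simp add: rot_root_def nu_root_Delta_iso eta_root_Delta_iso)

section \<open>The root attached to an integer\<close>

lemma row_unique: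
  assumes "int n dvd x + int m * int i" "int n dvd x + int m * int i'" "i \<in> {1..n}" "i' \<in> {1..n}"
  shows "i = i'"
proof -
  have "int n dvd int m * int i - int m * int i'"
    using dvd_diff[OF assms(1,2)] by simp
  then have "int n dvd int i - int i'"
    using dvd_cancel_m[of "int i - int i'"] by (simp add: right_diff_distrib)
  then show ?thesis using residue_unique assms(3,4) by blast
qed

lemma col_unique:
  assumes "int m dvd x - int n * (int j - 1)" "int m dvd x - int n * (int j' - 1)"
    "j \<in> {1..m}" "j' \<in> {1..m}"
  shows "j = j'"
proof -
  have "int m dvd int n * (int j' - int j)"
    using dvd_diff[OF assms(1,2)] by (simp add: algebra_simps)
  then have "int m dvd int j' - int j" using dvd_cancel_n by blast
  then show ?thesis using residue_unique[of m j' j] assms(3,4) by blast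
qed

lemma content_unique:
  assumes "content \<alpha> x" "content \<beta> x" "\<alpha> \<in> Delta_iso n m" "\<beta> \<in> Delta_iso n m"
    "positive \<alpha> \<longleftrightarrow> positive \<beta>"
  shows "\<alpha> = \<beta>"
  using assms row_unique[of x] col_unique[of x]
  by (cases \<alpha>; cases \<beta>) (simp_all del: atLeastAtMost_iff One_nat_def)

lemma content_exists:
  obtains \<alpha> where "\<alpha> \<in> Delta_iso n m" "content \<alpha> x" "\<not> positive \<alpha>"
proof -
  obtain i where i: "i \<in> {1..n}" "int n dvd x + int m * int i" by (rule row_residue)
  obtain j where "j \<in> {1..m}" "int m dvd x - int n * (int j - 1)" by (rule col_residue)
  then show ?thesis using i by (intro that[of "delta_eps i j"]) auto
qed

text \<open>Adding and removing are one formula, so both signs are treated together and inverses are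
  immediate.\<close>

definition toggle :: "int \<Rightarrow> int set \<Rightarrow> int set" where
  "toggle x I = (if x \<in> I then I - {x} else insert x I)"

lemma toggle_toggle [simp]: "toggle x (toggle x I) = I"
  by (auto simp: toggle_def)

lemma translate_toggle: "translate c (toggle x I) = toggle (x + c) (translate c I)"
  by (auto simp: toggle_def)

lemma ideals_closed:
  assumes "I \<in> ideals" "x \<in> I"
  shows "x - int n \<in> I" "x - int m \<in> I"
  using assms by (auto simp: ideals_def)

lemma not_ideals_closed:
  assumes "I \<in> ideals" "x \<notin> I"
  shows "x + int n \<notin> I" "x + int m \<notin> I"
  using ideals_closed[OF assms(1), of "x + int n"] ideals_closed[OF assms(1), of "x + int m"] assms(2) by auto

text \<open>Two of the four facts are part of \<open>corner\<close>, the other two follow from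
  closure; the result no longer depends on the sign.\<close>

lemma corner_neighbours:
  assumes "I \<in> ideals" "corner \<alpha> I x"
  shows "x - int n \<in> I" "x - int m \<in> I" "x + int n \<notin> I" "x + int m \<notin> I"
  using assms ideals_closed[of I x] not_ideals_closed[of I x]
  by (auto simp: corner_def split: if_splits)

lemma corner_insert_remove:
  assumes I: "I \<in> ideals" and c: "corner \<alpha> I x"
  shows "insert x I \<in> ideals" "I - {x} \<in> ideals"
proof -
  note N = corner_neighbours[OF I c]
  have "x + int n \<notin> insert x I" using N n_pos by simp
  then show "insert x I \<in> ideals"
    using N I unfolding ideals_def by blast
  \<comment> \<open>A \<open>y\<close> in \<open>I\<close> violating this would be
    \<open>x + n\<close> or \<open>x + m\<close>.\<close>
  have "y - int n \<noteq> x \<and> y - int m \<noteq> x" if "y \<in> I" for y using N that by force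
  moreover have "x - int n \<in> I - {x}" using N n_pos by simp
  moreover have "I - {x} \<noteq> UNIV" by blast
  ultimately show "I - {x} \<in> ideals"
    using I unfolding ideals_def by blast
qed

lemma corner_toggle:
  assumes I: "I \<in> ideals" and c: "corner \<alpha> I x"
  shows "corner (neg_root \<alpha>) (toggle x I) x" "toggle x I \<in> ideals"
proof -
  show "corner (neg_root \<alpha>) (toggle x I) x"
    using c corner_neighbours[OF I c] n_pos m_pos
    by (auto simp: corner_def toggle_def)
  show "toggle x I \<in> ideals"
    using corner_insert_remove[OF I c] by (simp add: toggle_def)
qed

lemma corner_border:
  assumes I: "I \<in> ideals" and b: "border I \<Lambda>"
  shows "corner (eps_delta i j) I x \<Longrightarrow> x = fst \<Lambda> i \<and> x = snd \<Lambda> j"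
    and "corner (delta_eps i j) I x \<Longrightarrow> x + int n = fst \<Lambda> i \<and> x + int m = snd \<Lambda> j"
proof -
  assume c: "corner (eps_delta i j) I x"
  then have i: "i \<in> {1..n}" "int n dvd x + int m * int i" "x \<notin> I" "x - int n \<in> I"
    and j: "j \<in> {1..m}" "int m dvd x - int n * (int j - 1)" "x - int m \<in> I"
    by (simp_all add: corner_def)
  have "x = fst \<Lambda> i"
    using b i by (intro step_unique[OF I, of n]) (auto simp: border_def intro: dvd_diff_cancel)
  moreover have "x = snd \<Lambda> j"
    using b i j by (intro step_unique[OF I, of m]) (auto simp: border_def intro: dvd_diff_cancel)
  ultimately show "x = fst \<Lambda> i \<and> x = snd \<Lambda> j" ..
next
  assume c: "corner (delta_eps i j) I x"
  then have i: "i \<in> {1..n}" "int n dvd x + int m * int i" "x + int n \<notin> I" "x \<in> I"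
    and j: "j \<in> {1..m}" "int m dvd x - int n * (int j - 1)" "x + int m \<notin> I"
    by (simp_all add: corner_def)
  have "int n dvd (x + int n) + int m * int i"
    using dvd_add[OF i(2) dvd_refl] by (simp add: algebra_simps)
  then have "x + int n = fst \<Lambda> i"
    using b i by (intro step_unique[OF I, of n]) (auto simp: border_def intro: dvd_diff_cancel)
  moreover have "int m dvd (x + int m) - int n * (int j - 1)"
    using dvd_add[OF j(2) dvd_refl] by (simp add: algebra_simps)
  then have "x + int m = snd \<Lambda> j"
    using b i j by (intro step_unique[OF I, of m]) (auto simp: border_def intro: dvd_diff_cancel)
  ultimately show "x + int n = fst \<Lambda> i \<and> x + int m = snd \<Lambda> j" ..
qed

lemma corner_unique:
  assumes I: "I \<in> ideals" and c: "corner \<alpha> I x" "corner \<alpha> I y"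
  shows "x = y"
proof (cases \<alpha>)
  case (eps_delta i j)
  then show ?thesis
    using corner_border(1)[OF I border_xhat[OF I], of i j x]
      corner_border(1)[OF I border_xhat[OF I], of i j y] c by simp
next
  case (delta_eps i j)
  then show ?thesis
    using corner_border(2)[OF I border_xhat[OF I], of i j x]
      corner_border(2)[OF I border_xhat[OF I], of i j y] c by simp
qed

section \<open>Corners, hyperplanes and the maps \<open>tau\<close>\<close>

lemma hyperplane_iff:
  assumes "i \<in> {1..n}" "j \<in> {1..m}"
  shows "\<Lambda> \<in> hyperplane n m (eps_delta i j) \<longleftrightarrow> \<Lambda> \<in> lattice n m \<and> fst \<Lambda> i = snd \<Lambda> j"
    and "\<Lambda> \<in> hyperplane n m (delta_eps i j) \<longleftrightarrow>
      \<Lambda> \<in> lattice n m \<and> fst \<Lambda> i - int n = snd \<Lambda> j - int m"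
  using form_eps_minus_delta[OF assms, of "fst \<Lambda>" "snd \<Lambda>"]
  by (auto simp del: root_vec.simps)

lemma corner_iff_hyperplane:
  assumes I: "I \<in> ideals" and b: "border I \<Lambda>" and \<alpha>: "\<alpha> \<in> Delta_iso n m"
  shows "(\<exists>x. corner \<alpha> I x) \<longleftrightarrow> \<Lambda> \<in> hyperplane n m \<alpha>"
proof (cases \<alpha>)
  case (eps_delta i j)
  then have ij: "i \<in> {1..n}" "j \<in> {1..m}" using \<alpha> by auto
  have L: "\<Lambda> \<in> lattice n m" using b by (simp add: border_def)
  have "corner \<alpha> I (fst \<Lambda> i)" if "fst \<Lambda> i = snd \<Lambda> j"
    using border_row[OF b ij(1)] border_col[OF b ij(2)] that ij eps_delta
    by (simp add: corner_def)
  then show ?thesis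
    using corner_border(1)[OF I b] hyperplane_iff(1)[OF ij] eps_delta L by metis
next
  case (delta_eps i j)
  then have ij: "i \<in> {1..n}" "j \<in> {1..m}" using \<alpha> by auto
  have L: "\<Lambda> \<in> lattice n m" using b by (simp add: border_def)
  have "corner \<alpha> I (fst \<Lambda> i - int n)" if eq: "fst \<Lambda> i - int n = snd \<Lambda> j - int m"
  proof -
    note 1 = border_row[OF b ij(1)] border_col[OF b ij(2)]
    have "int n dvd fst \<Lambda> i - int n + int m * int i"
      using dvd_diff[OF 1(1) dvd_refl] by (simp add: algebra_simps)
    moreover have "int m dvd fst \<Lambda> i - int n - int n * (int j - 1)"
      unfolding eq using dvd_diff[OF 1(4) dvd_refl] by (simp add: algebra_simps)
    moreover have "fst \<Lambda> i - int n + int m = snd \<Lambda> j" using eq by simp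
    ultimately show ?thesis using 1 delta_eps ij by (simp add: corner_def)
  qed
  moreover have "fst \<Lambda> i - int n = snd \<Lambda> j - int m" if "corner \<alpha> I x" for x
    using corner_border(2)[OF I b] that delta_eps by (metis add_diff_cancel_right')
  ultimately show ?thesis
    using hyperplane_iff(2)[OF ij] delta_eps L by metis
qed

text \<open>\<open>delta j\<close> has second component \<open>-1\<close>, so subtracting
  \<open>m\<close> copies of it raises \<open>b_j\<close> by \<open>m\<close>.\<close>

lemma tau_eq:
  "tau n m (eps_delta i j) \<Lambda> = (\<lambda>k. fst \<Lambda> k + (if k = i then int n else 0), \<lambda>k. snd \<Lambda> k + (if k = j then int m else 0))"
  "tau n m (delta_eps i j) \<Lambda> = (\<lambda>k. fst \<Lambda> k - (if k = i then int n else 0), \<lambda>k. snd \<Lambda> k - (if k = j then int m else 0))"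
  by (auto simp: shift_vec_def scale_def eps_def delta_def fun_eq_iff prod_eq_iff)

lemma tau_hyperplane:
  assumes "\<alpha> \<in> Delta_iso n m" "\<Lambda> \<in> hyperplane n m \<alpha>"
  shows "tau n m \<alpha> \<Lambda> \<in> hyperplane n m (neg_root \<alpha>)" "tau n m (neg_root \<alpha>) (tau n m \<alpha> \<Lambda>) = \<Lambda>"
proof -
  show "tau n m \<alpha> \<Lambda> \<in> hyperplane n m (neg_root \<alpha>)"
    using assms hyperplane_iff
    by (cases \<alpha>) (auto simp: tau_eq lattice_def simp del: hyperplane.simps tau.simps)
  show "tau n m (neg_root \<alpha>) (tau n m \<alpha> \<Lambda>) = \<Lambda>"
    by (cases \<alpha>) (auto simp: tau_eq simp del: tau.simps)
qed

text \<open>Only the residue classes of \<open>x\<close> are affected: the exit in row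
  \<open>i\<close> moves by \<open>n\<close> and the exit in column \<open>j\<close> by
  \<open>m\<close>, in the direction of the sign.\<close>

lemma border_toggle:
  assumes I: "I \<in> ideals" and b: "border I \<Lambda>" and c: "corner \<alpha> I x"
  shows "border (toggle x I) (tau n m \<alpha> \<Lambda>)"
proof -
  note A = border_row[OF b] and B = border_col[OF b]
  have L: "\<Lambda> \<in> lattice n m" using b by (simp add: border_def)
  note N = corner_neighbours[OF I c]
  show ?thesis
  proof (cases \<alpha>)
    case (eps_delta i j)
    have x: "fst \<Lambda> i = x" "snd \<Lambda> j = x" using corner_border(1)[OF I b] c eps_delta by auto
    have ij: "i \<in> {1..n}" "j \<in> {1..m}" and "x \<notin> I" using c eps_delta by (auto simp: corner_def)
    then have J: "toggle x I = insert x I" by (simp add: toggle_def)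
    \<comment> \<open>Entries of other rows and columns lie in other residue classes, so they stay
      outside after \<open>x\<close> is inserted.\<close>
    have "fst \<Lambda> k \<noteq> x" if "k \<in> {1..n}" "k \<noteq> i" for k
      using row_unique[of x k i] A(1)[OF that(1)] A(1)[OF ij(1)] that ij x by auto
    moreover have "snd \<Lambda> k \<noteq> x" if "k \<in> {1..m}" "k \<noteq> j" for k
      using col_unique[of x k j] B(1)[OF that(1)] B(1)[OF ij(2)] that ij x by auto
    moreover have "int n dvd x + int n + int m * int i"
      using dvd_add[OF A(1)[OF ij(1)] dvd_refl] x by (simp add: algebra_simps)
    moreover have "int m dvd x + int m - int n * (int j - 1)"
      using dvd_add[OF B(1)[OF ij(2)] dvd_refl] x by (simp add: algebra_simps)
    moreover have "tau n m \<alpha> \<Lambda> \<in> lattice n m"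
      using L ij unfolding eps_delta tau_eq by (auto simp: lattice_def)
    ultimately show ?thesis
      using A B x N n_pos m_pos unfolding border_def J
      by (auto simp: eps_delta tau_eq simp del: tau.simps)
  next
    case (delta_eps i j)
    have x: "fst \<Lambda> i = x + int n" "snd \<Lambda> j = x + int m" using corner_border(2)[OF I b] c delta_eps by auto
    have ij: "i \<in> {1..n}" "j \<in> {1..m}" and "x \<in> I" using c delta_eps by (auto simp: corner_def)
    then have J: "toggle x I = I - {x}" by (simp add: toggle_def)
    \<comment> \<open>For removal the elements at risk are the last ones inside \<open>I\<close>,
      one step before the entries.\<close>
    have "fst \<Lambda> k - int n \<noteq> x" if "k \<in> {1..n}" "k \<noteq> i" for k
      using row_unique[of "x + int n" k i] A(1)[OF that(1)] A(1)[OF ij(1)] that ij x by auto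
    moreover have "snd \<Lambda> k - int m \<noteq> x" if "k \<in> {1..m}" "k \<noteq> j" for k
      using col_unique[of "x + int m" k j] B(1)[OF that(1)] B(1)[OF ij(2)] that ij x by auto
    moreover have "int n dvd x + int m * int i"
      using dvd_diff[OF A(1)[OF ij(1)] dvd_refl] x by (simp add: algebra_simps)
    moreover have "int m dvd x - int n * (int j - 1)"
      using dvd_diff[OF B(1)[OF ij(2)] dvd_refl] x by (simp add: algebra_simps)
    moreover have "tau n m \<alpha> \<Lambda> \<in> lattice n m"
      using L ij unfolding delta_eps tau_eq by (auto simp: lattice_def)
    ultimately show ?thesis
      using A B x N n_pos m_pos unfolding border_def J
      by (auto simp: delta_eps tau_eq simp del: tau.simps)
  qed
qed

subsection \<open>Corners of diagrams\<close>

definition box_value :: "nat \<Rightarrow> nat \<Rightarrow> int" where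
  "box_value i j = int m * int (n - i) + int n * (int j - 1)"

lemma mem_boxes:
  assumes "i \<in> {1..n}" "j \<in> {1..m}"
  shows "(i, j) \<in> boxes n m p \<longleftrightarrow> box_value i j \<in> ideal p 0"
proof -
  have "n - i < n" "Suc (n - i) = n + 1 - i" using assms by auto
  then show ?thesis
    using mem_ideal'[of "n - i" "box_value i j" 0 "int j - 1" p] assms
    by (auto simp: boxes_def box_value_def)
qed

lemma boxes_subset: "boxes n m p \<subseteq> {1..n} \<times> {1..m}"
  by (auto simp: boxes_def)

lemma box_value_inj:
  assumes "box_value i j = box_value i' j'" "i \<in> {1..n}" "i' \<in> {1..n}"
  shows "i = i' \<and> j = j'"
proof -
  have "n - i < n" "n - i' < n" using assms by auto
  from coordinates_unique[OF assms(1)[unfolded box_value_def] this] show ?thesis using assms(2,3) by auto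
qed

text \<open>The split is by the column coordinate: negative columns form the ideal of the empty
  diagram, the others are boxes.\<close>

lemma ideal_boxes:
  assumes p: "p \<in> diagrams n m"
  shows "ideal p 0 = ideal empty_part 0 \<union> (\<lambda>(i, j). box_value i j) ` boxes n m p"
proof (rule set_eqI)
  fix x
  obtain r c where r: "r < n" and x: "x = 0 + int m * int r + int n * c" by (rule coordinates)
  have mem: "x \<in> ideal q 0 \<longleftrightarrow> c < int (q (Suc r))" for q by (rule mem_ideal'[OF r x])
  show "x \<in> ideal p 0 \<longleftrightarrow> x \<in> ideal empty_part 0 \<union> (\<lambda>(i, j). box_value i j) ` boxes n m p"
  proof
    assume a: "x \<in> ideal p 0"
    show "x \<in> ideal empty_part 0 \<union> (\<lambda>(i, j). box_value i j) ` boxes n m p"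
    proof (cases "c < 0")
      case True
      then show ?thesis using mem[of empty_part] by (simp add: empty_part_def)
    next
      case False
      have rj: "n - r \<in> {1..n}" "nat c + 1 \<in> {1..m}"
        using False r a mem[of p] diagrams_le[OF p, of "Suc r"] by auto
      have "x = box_value (n - r) (nat c + 1)"
        using False r x by (simp add: box_value_def)
      moreover from this have "(n - r, nat c + 1) \<in> boxes n m p"
        using mem_boxes[OF rj, of p] a by simp
      ultimately show ?thesis by force
    qed
  next
    assume "x \<in> ideal empty_part 0 \<union> (\<lambda>(i, j). box_value i j) ` boxes n m p"
    then show "x \<in> ideal p 0"
    proof
      assume "x \<in> ideal empty_part 0"
      then show ?thesis using mem[of empty_part] mem[of p] by (simp add: empty_part_def)
    next
      assume "x \<in> (\<lambda>(i, j). box_value i j) ` boxes n m p"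
      then obtain i j where ij: "(i, j) \<in> boxes n m p" "x = box_value i j" by auto
      then have "i \<in> {1..n}" "j \<in> {1..m}" using boxes_subset[of p] by auto
      then show ?thesis using mem_boxes ij by simp
    qed
  qed
qed

lemma boxes_inj:
  assumes "p \<in> diagrams n m" "q \<in> diagrams n m" "boxes n m p = boxes n m q"
  shows "p = q"
  using ideal_inj[OF assms(1,2), of 0] ideal_boxes[OF assms(1)] ideal_boxes[OF assms(2)] assms(3) by simp

lemma ideal_insert_box:
  assumes "p \<in> diagrams n m" "q \<in> diagrams n m" "boxes n m q = insert (i, j) (boxes n m p)"
  shows "ideal q 0 = insert (box_value i j) (ideal p 0)"
  using ideal_boxes[OF assms(1)] ideal_boxes[OF assms(2)] assms(3) by simp

lemma t_box_eps_delta: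
  assumes "\<mu> \<in> diagrams n m" "boxes n m \<mu> = insert (i, j) (boxes n m p)"
  shows "t_box n m (eps_delta i j) p = \<mu>"
  using assms boxes_inj by (auto intro!: the_equality)

lemma t_box_delta_eps:
  assumes "\<mu> \<in> diagrams n m" "boxes n m \<mu> = boxes n m p - {(i, j)}"
  shows "t_box n m (delta_eps i j) p = \<mu>"
  using assms boxes_inj by (auto intro!: the_equality)

lemma content_box_value:
  assumes "i \<in> {1..n}"
  shows "content (eps_delta i j) (box_value i j)" "content (delta_eps i j) (box_value i j)"
proof -
  have "box_value i j + int m * int i = int n * (int m + int j - 1)"
    using assms by (simp add: box_value_def of_nat_diff algebra_simps)
  then have "int n dvd box_value i j + int m * int i" by simp
  moreover have "int m dvd box_value i j - int n * (int j - 1)" by (simp add: box_value_def)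
  ultimately show "content (eps_delta i j) (box_value i j)" "content (delta_eps i j) (box_value i j)"
    by simp_all
qed

text \<open>The corner is the value of the box. Closure of the larger ideal gives the predecessors
  when a box is added; closure of the complement of the smaller one gives the successors when it is
  removed.\<close>

lemma corner_X_dom:
  assumes \<beta>: "\<beta> \<in> Delta_iso n m" and p: "p \<in> X_dom n m \<beta>"
  obtains x where "corner \<beta> (ideal p 0) x" "t_box n m \<beta> p \<in> diagrams n m"
    "ideal (t_box n m \<beta> p) 0 = toggle x (ideal p 0)"
proof (cases \<beta>)
  case (eps_delta i j)
  then have ij: "i \<in> {1..n}" "j \<in> {1..m}" using \<beta> by auto
  obtain \<mu> where pd: "p \<in> diagrams n m" and \<mu>: "\<mu> \<in> diagrams n m"
    and b: "(i, j) \<notin> boxes n m p" "boxes n m \<mu> = insert (i, j) (boxes n m p)"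
    using p eps_delta by auto
  let ?x = "box_value i j"
  have x: "?x \<notin> ideal p 0" using mem_boxes[OF ij] b by simp
  have I: "ideal \<mu> 0 = insert ?x (ideal p 0)" using ideal_insert_box[OF pd \<mu> b(2)] .
  have "?x - int n \<in> ideal \<mu> 0" "?x - int m \<in> ideal \<mu> 0"
    using ideals_closed[OF ideal_in_ideals[OF \<mu>], of ?x 0] I by auto
  then have "corner \<beta> (ideal p 0) ?x"
    using x I n_pos m_pos eps_delta ij content_box_value(1)[OF ij(1), of j] by (simp add: corner_def del: content.simps)
  then show ?thesis
    using that[of ?x] t_box_eps_delta[OF \<mu> b(2)] \<mu> I x eps_delta by (simp add: toggle_def del: t_box.simps)
next
  case (delta_eps i j)
  then have ij: "i \<in> {1..n}" "j \<in> {1..m}" using \<beta> by auto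
  obtain \<mu> where pd: "p \<in> diagrams n m" and \<mu>: "\<mu> \<in> diagrams n m"
    and b: "(i, j) \<in> boxes n m p" "boxes n m \<mu> = boxes n m p - {(i, j)}"
    using p delta_eps by auto
  let ?x = "box_value i j"
  have x: "?x \<in> ideal p 0" "?x \<notin> ideal \<mu> 0" using mem_boxes[OF ij, of p] mem_boxes[OF ij, of \<mu>] b by simp_all
  have "boxes n m p = insert (i, j) (boxes n m \<mu>)" using b by auto
  from ideal_insert_box[OF \<mu> pd this] have I: "ideal p 0 = insert ?x (ideal \<mu> 0)" .
  have "?x + int n \<notin> ideal \<mu> 0" "?x + int m \<notin> ideal \<mu> 0"
    using not_ideals_closed[OF ideal_in_ideals[OF \<mu>], of ?x 0] x by auto
  then have "corner \<beta> (ideal p 0) ?x"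
    using x I n_pos m_pos delta_eps ij content_box_value(2)[OF ij(1), of j] by (simp add: corner_def del: content.simps)
  then show ?thesis
    using that[of ?x] t_box_delta_eps[OF \<mu> b(2)] \<mu> I x delta_eps by (simp add: toggle_def del: t_box.simps)
qed

text \<open>Computed at offset \<open>0\<close> and translated back. With
  \<open>corner_unique\<close> it shows that the result is independent of the
  representative.\<close>

lemma corner_of_rep:
  assumes \<alpha>: "\<alpha> \<in> Delta_iso n m" and I: "ideal p (i * int n + j * int m) = I"
    and p: "p \<in> X_dom n m (rot_root n m i j \<alpha>)"
  obtains x where "corner \<alpha> I x"
    "cls n m (t_box n m (rot_root n m i j \<alpha>) p) (i * int n + j * int m) = class_of (toggle x I)"
proof -
  define k where "k = i * int n + j * int m"
  define \<beta> where "\<beta> = rot_root n m i j \<alpha>"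
  have "\<beta> \<in> Delta_iso n m" using \<alpha> by (simp add: \<beta>_def rot_root_Delta_iso)
  then obtain x where x: "corner \<beta> (ideal p 0) x" "t_box n m \<beta> p \<in> diagrams n m"
    "ideal (t_box n m \<beta> p) 0 = toggle x (ideal p 0)"
    using corner_X_dom p unfolding \<beta>_def by blast
  have t: "translate k (ideal p 0) = I" using I by (simp add: translate_ideal k_def)
  then have t': "translate (- k) I = ideal p 0" by auto
  have "corner \<alpha> I (x + k)"
    using corner_rot_root[of i j \<alpha> I "x + k"] x(1) t' by (simp add: k_def \<beta>_def)
  moreover have "ideal (t_box n m \<beta> p) k = toggle (x + k) I"
    using arg_cong[OF x(3), of "translate k"] I by (simp add: translate_ideal translate_toggle k_def)
  then have "cls n m (t_box n m \<beta> p) k = class_of (toggle (x + k) I)"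
    using cls_eq[OF x(2), of k] by simp
  ultimately show ?thesis using that by (simp add: k_def \<beta>_def)
qed

text \<open>The representative is chosen so that the corner box is the lower left box of the rectangle.\<close>

lemma rep_of_corner:
  assumes I: "I \<in> ideals" and c: "corner \<alpha> I x"
  obtains p i j where "p \<in> diagrams n m" "ideal p (i * int n + j * int m) = I"
    "p \<in> X_dom n m (rot_root n m i j \<alpha>)"
proof -
  note N = corner_neighbours[OF I c]
  \<comment> \<open>This offset makes \<open>x\<close> the value of box \<open>(1, 1)\<close>:
    \<open>x - k = m (n - 1)\<close>. The conditions of \<open>ideal_surj_at\<close> become
    \<open>x + m\<close> outside and \<open>x - n\<close> inside.\<close>
  define k where "k = x + int m - int n * int m"
  obtain i j where ij: "k = i * int n + j * int m" by (rule bezout)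
  \<comment> \<open>\<open>p\<close> and \<open>q\<close> are the diagrams without and with
    \<open>x\<close>; one of them represents \<open>I\<close>, depending on the sign of
    \<open>\<alpha>\<close>.\<close>
  obtain p where p: "p \<in> diagrams n m" "ideal p k = I - {x}"
    by (rule ideal_surj_at[OF corner_insert_remove(2)[OF I c], of k]) (use N n_pos in \<open>auto simp: k_def\<close>)
  obtain q where q: "q \<in> diagrams n m" "ideal q k = insert x I"
    by (rule ideal_surj_at[OF corner_insert_remove(1)[OF I c], of k]) (use N m_pos in \<open>auto simp: k_def\<close>)
  have one: "1 \<in> {1..n}" "1 \<in> {1..m}" using n_pos m_pos by auto
  have x: "x - k = box_value 1 1"
    using n_pos by (simp add: box_value_def k_def of_nat_diff algebra_simps)
  have p0: "ideal p 0 = translate (- k) (I - {x})" and q0: "ideal q 0 = translate (- k) (insert x I)"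
    using translate_ideal[of "- k" p k] translate_ideal[of "- k" q k] p q by simp_all
  have mem: "y \<in> ideal q 0 \<longleftrightarrow> y = box_value 1 1 \<or> y \<in> ideal p 0" for y
    unfolding p0 q0 using x by auto
  have b: "(i, j) \<in> boxes n m q \<longleftrightarrow> (i, j) = (1, 1) \<or> (i, j) \<in> boxes n m p" for i j
  proof (cases "i \<in> {1..n} \<and> j \<in> {1..m}")
    case True
    then show ?thesis
      using mem_boxes[of i j p] mem_boxes[of i j q] mem[of "box_value i j"] box_value_inj[of i j 1 1] one
      by auto
  next
    case False
    then show ?thesis using boxes_subset[of p] boxes_subset[of q] one by blast
  qed
  have "box_value 1 1 \<notin> ideal p 0" unfolding p0 using x by auto
  then have nb: "(1, 1) \<notin> boxes n m p" using mem_boxes[OF one] by simp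
  have ins: "boxes n m q = insert (1, 1) (boxes n m p)" using b by auto
  then have rem: "boxes n m p = boxes n m q - {(1, 1)}" using nb by auto
  define \<beta> where "\<beta> = rot_root n m i j \<alpha>"
  \<comment> \<open>The rotated root has a corner at the value of box \<open>(1, 1)\<close>, so its
    residues and sign determine it.\<close>
  have c\<beta>: "corner \<beta> (translate (- k) I) (box_value 1 1)"
    using corner_rot_root[of i j \<alpha> I x] c x by (simp add: \<beta>_def ij)
  show ?thesis
  proof (cases "positive \<alpha>")
    case True
    have "\<beta> = eps_delta 1 1"
      using c\<beta> content_unique[of \<beta> "box_value 1 1" "eps_delta 1 1"] content_box_value(1)[OF one(1)]
        positive_rot_root[of i j \<alpha>] True one by (auto simp: corner_def \<beta>_def simp del: content.simps)
    moreover have "p \<in> X_dom n m (eps_delta 1 1)"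
      using p(1) nb q(1) ins by (simp only: X_dom.simps) blast
    moreover have "I - {x} = I" using c True by (auto simp: corner_def)
    ultimately show ?thesis
      using p unfolding ij \<beta>_def by (intro that[of p i j]) simp_all
  next
    case False
    have "\<beta> = delta_eps 1 1"
      using c\<beta> content_unique[of \<beta> "box_value 1 1" "delta_eps 1 1"] content_box_value(2)[OF one(1)]
        positive_rot_root[of i j \<alpha>] False one by (auto simp: corner_def \<beta>_def simp del: content.simps)
    moreover have "(1, 1) \<in> boxes n m q" using ins by blast
    then have "q \<in> X_dom n m (delta_eps 1 1)"
      using q(1) p(1) rem by (simp only: X_dom.simps) blast
    moreover have "insert x I = I" using c False by (auto simp: corner_def)
    ultimately show ?thesis
      using q unfolding ij \<beta>_def by (intro that[of q i j]) simp_all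
  qed
qed

subsection \<open>The action on ideals\<close>

definition ideal_dom :: "iso_root \<Rightarrow> int set set" where
  "ideal_dom \<alpha> = {I \<in> ideals. \<exists>x. corner \<alpha> I x}"

definition ideal_act :: "iso_root \<Rightarrow> int set \<Rightarrow> int set" where
  "ideal_act \<alpha> I = toggle (THE x. corner \<alpha> I x) I"

lemma ideal_act_eq:
  assumes "I \<in> ideals" "corner \<alpha> I x"
  shows "ideal_act \<alpha> I = toggle x I"
  unfolding ideal_act_def using assms corner_unique[OF assms(1)] by (metis the_equality)

lemma ideal_act_dom:
  assumes "I \<in> ideal_dom \<alpha>"
  shows "ideal_act \<alpha> I \<in> ideal_dom (neg_root \<alpha>)" "ideal_act (neg_root \<alpha>) (ideal_act \<alpha> I) = I"
proof -
  obtain x where I: "I \<in> ideals" and x: "corner \<alpha> I x" using assms by (auto simp: ideal_dom_def)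
  note t = corner_toggle[OF I x]
  show "ideal_act \<alpha> I \<in> ideal_dom (neg_root \<alpha>)"
    using t ideal_act_eq[OF I x] by (auto simp: ideal_dom_def)
  show "ideal_act (neg_root \<alpha>) (ideal_act \<alpha> I) = I"
    using ideal_act_eq[OF I x] ideal_act_eq[OF t(2,1)] by simp
qed

lemma iso_action_ideals: "iso_action n m ideals ideal_dom ideal_act"
  unfolding iso_action_def
proof (intro ballI conjI)
  fix \<alpha>
  show "ideal_dom \<alpha> \<subseteq> ideals" by (auto simp: ideal_dom_def)
  show "bij_betw (ideal_act \<alpha>) (ideal_dom \<alpha>) (ideal_dom (neg_root \<alpha>))"
    using ideal_act_dom[of _ \<alpha>] ideal_act_dom[of _ "neg_root \<alpha>"]
    by (intro bij_betw_byWitness[where f' = "ideal_act (neg_root \<alpha>)"]) auto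
qed (rule ideal_act_dom(2))

text \<open>The largest element of \<open>I - J\<close> is a removable corner of \<open>I\<close>, so the symmetric difference
  can be shrunk.\<close>

lemma remove_corner:
  assumes I: "I \<in> ideals" and J: "J \<in> ideals" and ne: "I - J \<noteq> {}"
  obtains x where "x \<in> I - J" "I - {x} \<in> ideals"
    "(I, I - {x}) \<in> action_edges n m ideal_dom ideal_act"
proof -
  define x where "x = Max (I - J)"
  have fin: "finite (I - J)" using finite_ideals_diff[OF I J] .
  then have x: "x \<in> I - J" using ne unfolding x_def by (rule Max_in)
  have "x + int n \<notin> I - J" "x + int m \<notin> I - J"
    using Max_ge[OF fin, of "x + int n"] Max_ge[OF fin, of "x + int m"] n_pos m_pos
    by (auto simp: x_def[symmetric])
  moreover have "x + int n \<notin> J" "x + int m \<notin> J" using not_ideals_closed[OF J] x by auto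
  moreover obtain \<alpha> where \<alpha>: "\<alpha> \<in> Delta_iso n m" "content \<alpha> x" "\<not> positive \<alpha>"
    by (rule content_exists)
  ultimately have c: "corner \<alpha> I x" using x by (simp add: corner_def)
  have t: "toggle x I = I - {x}" using x by (simp add: toggle_def)
  show ?thesis
  proof (rule that[OF x])
    show "I - {x} \<in> ideals" using corner_insert_remove(2)[OF I c] .
    have "I \<in> ideal_dom \<alpha>" using I c by (auto simp: ideal_dom_def)
    from action_edgesI[OF \<alpha>(1), of I ideal_dom ideal_act, OF this]
    show "(I, I - {x}) \<in> action_edges n m ideal_dom ideal_act"
      using ideal_act_eq[OF I c] t by simp
  qed
qed

text \<open>Induction on the size of the symmetric difference. A corner is removed from whichever
  ideal has an element outside the other; for \<open>J\<close> the edge is used backwards.\<close>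

lemma ideals_connected:
  assumes "I \<in> ideals" "J \<in> ideals"
  shows "(I, J) \<in> (action_edges n m ideal_dom ideal_act \<union> (action_edges n m ideal_dom ideal_act)\<inverse>)\<^sup>*"
    (is "_ \<in> ?E\<^sup>*")
  using assms
proof (induction "card (I - J) + card (J - I)" arbitrary: I J rule: less_induct)
  case less
  note fin = finite_ideals_diff[OF less.prems] finite_ideals_diff[OF less.prems(2,1)]
  consider "I = J" | "I - J \<noteq> {}" | "J - I \<noteq> {}" by blast
  then show ?case
  proof cases
    case 2
    obtain x where x: "x \<in> I - J" "I - {x} \<in> ideals" "(I, I - {x}) \<in> ?E"
      using remove_corner[OF less.prems 2] by blast
    have eq: "I - {x} - J = (I - J) - {x}" "J - (I - {x}) = J - I" using x(1) by auto
    have "card (I - {x} - J) < card (I - J)"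
      unfolding eq using fin(1) x(1) by (rule card_Diff1_less)
    then have "(I - {x}, J) \<in> ?E\<^sup>*" using less.hyps x(2) less.prems(2) eq by simp
    then show ?thesis using x(3) by (rule converse_rtrancl_into_rtrancl[rotated])
  next
    case 3
    obtain x where x: "x \<in> J - I" "J - {x} \<in> ideals" "(J - {x}, J) \<in> ?E"
      using remove_corner[OF less.prems(2,1) 3] by blast
    have eq: "J - {x} - I = (J - I) - {x}" "I - (J - {x}) = I - J" using x(1) by auto
    have "card (J - {x} - I) < card (J - I)"
      unfolding eq using fin(2) x(1) by (rule card_Diff1_less)
    then have "(I, J - {x}) \<in> ?E\<^sup>*" using less.hyps x(2) less.prems(1) eq by simp
    then show ?thesis using x(3) by (rule rtrancl.rtrancl_into_rtrancl)
  qed simp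
qed

section \<open>Transport of the action to equivalence classes\<close>

lemma class_dom_eq:
  assumes \<alpha>: "\<alpha> \<in> Delta_iso n m"
  shows "class_of ` ideal_dom \<alpha> = class_dom n m \<alpha>"
proof
  show "class_of ` ideal_dom \<alpha> \<subseteq> class_dom n m \<alpha>"
  proof
    fix C assume "C \<in> class_of ` ideal_dom \<alpha>"
    then obtain I x where I: "I \<in> ideals" and x: "corner \<alpha> I x" and C: "C = class_of I"
      by (auto simp: ideal_dom_def)
    obtain p i j where "p \<in> diagrams n m" "ideal p (i * int n + j * int m) = I"
      "p \<in> X_dom n m (rot_root n m i j \<alpha>)"
      by (rule rep_of_corner[OF I x])
    moreover have "C \<in> classes n m" using bij_class_of I C by (auto simp: bij_betw_def)
    ultimately show "C \<in> class_dom n m \<alpha>"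
      using C by (auto simp: class_dom_def class_of_def)
  qed
  show "class_dom n m \<alpha> \<subseteq> class_of ` ideal_dom \<alpha>"
  proof
    fix C assume C: "C \<in> class_dom n m \<alpha>"
    then have "C \<in> class_of ` ideals" using bij_class_of by (auto simp: class_dom_def bij_betw_def)
    then obtain I where I: "I \<in> ideals" "C = class_of I" by auto
    obtain p i j where "(p, i * int n + j * int m) \<in> class_of I" "p \<in> X_dom n m (rot_root n m i j \<alpha>)"
      using C I by (auto simp: class_dom_def)
    then have "ideal p (i * int n + j * int m) = I" "p \<in> X_dom n m (rot_root n m i j \<alpha>)"
      by (simp_all add: class_of_def)
    then obtain x where "corner \<alpha> I x" by (rule corner_of_rep[OF \<alpha>])
    then show "C \<in> class_of ` ideal_dom \<alpha>" using I by (auto simp: ideal_dom_def)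
  qed
qed

text \<open>\<open>rep_of_corner\<close> provides a representative, and \<open>corner_of_rep\<close>
  with \<open>corner_unique\<close> gives all of them the same value, so \<open>THE\<close> denotes
  it.\<close>

lemma class_act_eq:
  assumes \<alpha>: "\<alpha> \<in> Delta_iso n m" and "I \<in> ideal_dom \<alpha>"
  shows "class_of (ideal_act \<alpha> I) = class_act n m \<alpha> (class_of I)"
proof -
  obtain x where I: "I \<in> ideals" and x: "corner \<alpha> I x" using assms(2) by (auto simp: ideal_dom_def)
  let ?rep = "\<lambda>p i j D. (p, i * int n + j * int m) \<in> class_of I \<and> p \<in> X_dom n m (rot_root n m i j \<alpha>) \<and>
        D = cls n m (t_box n m (rot_root n m i j \<alpha>) p) (i * int n + j * int m)"
  have val: "D = class_of (toggle x I)" if "?rep p i j D" for p i j D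
  proof -
    have "ideal p (i * int n + j * int m) = I" "p \<in> X_dom n m (rot_root n m i j \<alpha>)"
      using that by (simp_all add: class_of_def)
    then obtain y where "corner \<alpha> I y"
      "cls n m (t_box n m (rot_root n m i j \<alpha>) p) (i * int n + j * int m) = class_of (toggle y I)"
      by (rule corner_of_rep[OF \<alpha>])
    then show ?thesis using corner_unique[OF I x] that by blast
  qed
  obtain p i j where pij: "p \<in> diagrams n m" "ideal p (i * int n + j * int m) = I"
    "p \<in> X_dom n m (rot_root n m i j \<alpha>)"
    by (rule rep_of_corner[OF I x])
  then have rep: "?rep p i j (cls n m (t_box n m (rot_root n m i j \<alpha>) p) (i * int n + j * int m))"
    by (auto simp: class_of_def)
  have "class_act n m \<alpha> (class_of I) = class_of (toggle x I)"
    unfolding class_act_def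
  proof (rule the_equality)
    show "\<exists>p i j. ?rep p i j (class_of (toggle x I))" using rep val[OF rep] by auto
    show "D = class_of (toggle x I)" if "\<exists>p i j. ?rep p i j D" for D using that val by blast
  qed
  then show ?thesis using ideal_act_eq[OF I x] by simp
qed

subsection \<open>The orbit\<close>

definition ideal_vec :: "int set \<Rightarrow> svec" where
  "ideal_vec I = xhat n m (class_of I)"

lemma border_ideal_vec: "I \<in> ideals \<Longrightarrow> border I (ideal_vec I)"
  unfolding ideal_vec_def by (rule border_xhat)

lemma ideal_vec_hyperplane:
  assumes "\<alpha> \<in> Delta_iso n m" "I \<in> ideals"
  shows "ideal_vec I \<in> hyperplane n m \<alpha> \<longleftrightarrow> I \<in> ideal_dom \<alpha>"
  using corner_iff_hyperplane[OF assms(2) border_ideal_vec[OF assms(2)] assms(1)] assms(2)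
  by (simp add: ideal_dom_def)

text \<open>Both sides are borders of the toggled ideal.\<close>

lemma ideal_vec_act:
  assumes "I \<in> ideal_dom \<alpha>"
  shows "ideal_vec (ideal_act \<alpha> I) = tau n m \<alpha> (ideal_vec I)"
proof -
  obtain x where I: "I \<in> ideals" and x: "corner \<alpha> I x" using assms by (auto simp: ideal_dom_def)
  have t: "toggle x I \<in> ideals" using corner_toggle(2)[OF I x] .
  show ?thesis
    unfolding ideal_act_eq[OF I x]
    using border_unique[OF t border_ideal_vec[OF t] border_toggle[OF I border_ideal_vec[OF I] x]] .
qed

lemma empty_part_diagrams: "empty_part \<in> diagrams n m"
  by (simp add: empty_part_def diagrams_def)

lemma ideal_vec_empty: "ideal_vec (ideal empty_part 0) = Lambda0 n m"
proof -
  have "dual_part n empty_part j = 0" if "j \<ge> 1" for j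
    using that by (simp add: dual_part_def empty_part_def)
  then have "x_vec n m empty_part = Lambda0 n m"
    by (auto simp: x_vec_def Lambda0_def empty_part_def fun_eq_iff)
  then show ?thesis
    using border_unique[OF ideal_in_ideals border_ideal_vec[OF ideal_in_ideals] border_x_vec]
      empty_part_diagrams by metis
qed

text \<open>The image of the ideals contains \<open>Lambda0\<close> and is stable under all edges in
  the lattice, so it contains the orbit. Conversely, paths between ideals map to paths in the
  lattice.\<close>

lemma Lambda0_orbit_eq: "Lambda0_orbit n m = ideal_vec ` ideals"
proof
  let ?E = "action_edges n m ideal_dom ideal_act"
  let ?H = "action_edges n m (hyperplane n m) (tau n m)"
  have forward: "z \<in> ideal_vec ` ideals"
    if "y \<in> ideal_vec ` ideals" "\<alpha> \<in> Delta_iso n m" "y \<in> hyperplane n m \<alpha>" "z = tau n m \<alpha> y" for y z \<alpha>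
  proof -
    obtain I where I: "I \<in> ideals" "y = ideal_vec I" using \<open>y \<in> ideal_vec ` ideals\<close> by auto
    then have "I \<in> ideal_dom \<alpha>" using ideal_vec_hyperplane[OF \<open>\<alpha> \<in> _\<close>] \<open>y \<in> hyperplane n m \<alpha>\<close> by simp
    then have "z = ideal_vec (ideal_act \<alpha> I)" "ideal_act \<alpha> I \<in> ideals"
      using ideal_vec_act ideal_act_dom(1) \<open>z = _\<close> I by (auto simp: ideal_dom_def)
    then show ?thesis by simp
  qed
  show "Lambda0_orbit n m \<subseteq> ideal_vec ` ideals"
  proof
    fix y assume "y \<in> Lambda0_orbit n m"
    then have "(Lambda0 n m, y) \<in> (?H \<union> ?H\<inverse>)\<^sup>*" by (simp add: Lambda0_orbit_def action_orbit_def)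
    then show "y \<in> ideal_vec ` ideals"
    proof induction
      case base
      then show ?case using ideal_vec_empty ideal_in_ideals[OF empty_part_diagrams] by (metis imageI)
    next
      case (step y z)
      from step.hyps(2) show ?case
      proof
        assume "(y, z) \<in> ?H"
        then obtain \<alpha> where "\<alpha> \<in> Delta_iso n m" "y \<in> hyperplane n m \<alpha>" "z = tau n m \<alpha> y"
          by (auto simp: action_edges_def)
        then show ?thesis by (rule forward[OF step.IH])
      next
        assume "(y, z) \<in> ?H\<inverse>"
        then obtain \<alpha> where \<alpha>: "\<alpha> \<in> Delta_iso n m" "z \<in> hyperplane n m \<alpha>" "y = tau n m \<alpha> z"
          by (auto simp: action_edges_def)
        \<comment> \<open>A reversed edge is a forward edge for the negative root.\<close>
        have "neg_root \<alpha> \<in> Delta_iso n m" "y \<in> hyperplane n m (neg_root \<alpha>)"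
          "z = tau n m (neg_root \<alpha>) y"
          unfolding \<alpha>(3) using \<alpha>(1) by (simp_all only: tau_hyperplane[OF \<alpha>(1,2)] neg_root_Delta_iso)
        then show ?thesis by (rule forward[OF step.IH])
      qed
    qed
  qed
  show "ideal_vec ` ideals \<subseteq> Lambda0_orbit n m"
  proof
    fix y assume "y \<in> ideal_vec ` ideals"
    then obtain I where I: "I \<in> ideals" "y = ideal_vec I" by auto
    have edge: "(ideal_vec J, ideal_vec K) \<in> ?H" if e: "(J, K) \<in> ?E" for J K
    proof -
      obtain \<alpha> where \<alpha>: "\<alpha> \<in> Delta_iso n m" "J \<in> ideal_dom \<alpha>" "K = ideal_act \<alpha> J"
        using e by (auto simp: action_edges_def)
      then have "ideal_vec J \<in> hyperplane n m \<alpha>"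
        using ideal_vec_hyperplane[OF \<alpha>(1)] by (auto simp: ideal_dom_def)
      from action_edgesI[OF \<alpha>(1), of _ "hyperplane n m", OF this, of "tau n m"] show ?thesis
        unfolding \<alpha>(3) ideal_vec_act[OF \<alpha>(2)] .
    qed
    have "(ideal empty_part 0, I) \<in> (?E \<union> ?E\<inverse>)\<^sup>*"
      using ideals_connected ideal_in_ideals[OF empty_part_diagrams] I(1) by blast
    then have "(ideal_vec (ideal empty_part 0), ideal_vec I) \<in> (?H \<union> ?H\<inverse>)\<^sup>*"
      by (rule rtrancl_transfer) (use edge in auto)
    then show "y \<in> Lambda0_orbit n m"
      using I(2) ideal_vec_empty by (simp add: Lambda0_orbit_def action_orbit_def)
  qed
qed

section \<open>Assembling the equivariant bijection\<close>

lemma transitive_action_transfer: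
  assumes im: "\<omega> ` ideals = S'"
    and dom: "\<And>\<alpha>. \<alpha> \<in> Delta_iso n m \<Longrightarrow> \<omega> ` ideal_dom \<alpha> = D' \<alpha>"
    and eqv: "\<And>\<alpha> I. \<alpha> \<in> Delta_iso n m \<Longrightarrow> I \<in> ideal_dom \<alpha> \<Longrightarrow> \<omega> (ideal_act \<alpha> I) = F' \<alpha> (\<omega> I)"
  shows "transitive_action n m S' D' F'"
proof (rule transitive_actionI)
  show "\<omega> (ideal empty_part 0) \<in> S'" using im ideal_in_ideals[OF empty_part_diagrams] by auto
  fix x y assume "x \<in> S'" "y \<in> S'"
  then obtain I J where IJ: "I \<in> ideals" "J \<in> ideals" "x = \<omega> I" "y = \<omega> J" using im by auto
  have "(\<omega> I, \<omega> J) \<in> action_edges n m D' F'" if "(I, J) \<in> action_edges n m ideal_dom ideal_act" for I J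
    using that dom eqv by (auto simp: action_edges_def) blast
  then show "(x, y) \<in> (action_edges n m D' F' \<union> (action_edges n m D' F')\<inverse>)\<^sup>*"
    unfolding IJ(3,4) by (intro rtrancl_transfer[OF ideals_connected[OF IJ(1,2)]]) auto
qed

lemma xhat_equivariant_bijection:
  "equivariant_bijection n m (xhat n m)
     (classes n m) (class_dom n m) (class_act n m)
     (Lambda0_orbit n m) (\<lambda>\<alpha>. Lambda0_orbit n m \<inter> hyperplane n m \<alpha>) (tau n m)"
proof -
  let ?O = "Lambda0_orbit n m" and ?D = "\<lambda>\<alpha>. Lambda0_orbit n m \<inter> hyperplane n m \<alpha>"
  have inj: "inj_on ideal_vec ideals"
    using border_inj border_ideal_vec by (metis inj_onI)
  then have bij_vec: "bij_betw ideal_vec ideals ?O"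
    by (simp add: bij_betw_def Lambda0_orbit_eq)
  have sub: "ideal_dom \<alpha> \<subseteq> ideals" for \<alpha> by (auto simp: ideal_dom_def)
  have dom_vec: "ideal_vec ` ideal_dom \<alpha> = ?D \<alpha>" if "\<alpha> \<in> Delta_iso n m" for \<alpha>
    using ideal_vec_hyperplane[OF that] sub[of \<alpha>] unfolding Lambda0_orbit_eq by blast
  \<comment> \<open>As \<open>class_of\<close> is bijective, this factorisation turns properties of
    \<open>ideal_vec\<close> into properties of \<open>xhat\<close>.\<close>
  have comp: "ideal_vec = xhat n m \<circ> class_of" by (simp add: fun_eq_iff ideal_vec_def)
  have "bij_betw (xhat n m) (classes n m) ?O"
    using bij_vec bij_betw_comp_iff[OF bij_class_of] unfolding comp by blast
  moreover have "iso_action n m (classes n m) (class_dom n m) (class_act n m)"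
    by (rule iso_action_transfer[OF iso_action_ideals bij_class_of])
       (erule class_dom_eq, erule (1) class_act_eq)
  moreover have "iso_action n m ?O ?D (tau n m)"
    by (rule iso_action_transfer[OF iso_action_ideals bij_vec])
       (erule dom_vec, erule ideal_vec_act)
  moreover have "transitive_action n m (classes n m) (class_dom n m) (class_act n m)"
    by (rule transitive_action_transfer[OF bij_betw_imp_surj_on[OF bij_class_of]])
       (erule class_dom_eq, erule (1) class_act_eq)
  moreover have "transitive_action n m ?O ?D (tau n m)"
    by (rule transitive_action_transfer[OF Lambda0_orbit_eq[symmetric]])
       (erule dom_vec, erule ideal_vec_act)
  moreover have "xhat n m ` class_dom n m \<alpha> = ?D \<alpha>" if "\<alpha> \<in> Delta_iso n m" for \<alpha>
    using dom_vec[OF that] class_dom_eq[OF that] unfolding comp image_comp[symmetric] by simp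
  moreover have "xhat n m (class_act n m \<alpha> C) = tau n m \<alpha> (xhat n m C)"
    if \<alpha>: "\<alpha> \<in> Delta_iso n m" and C: "C \<in> class_dom n m \<alpha>" for \<alpha> C
  proof -
    obtain I where I: "I \<in> ideal_dom \<alpha>" "C = class_of I"
      using C class_dom_eq[OF \<alpha>] by auto
    then show ?thesis
      using class_act_eq[OF \<alpha> I(1)] ideal_vec_act[OF I(1)] by (simp add: ideal_vec_def)
  qed
  ultimately show ?thesis unfolding equivariant_bijection_def by blast
qed

lemma xhat_empty: "xhat n m (cls n m empty_part 0) = Lambda0 n m"
  using ideal_vec_empty cls_eq[OF empty_part_diagrams] by (simp add: ideal_vec_def)

end

theorem theorem1p1:
  fixes n m :: nat
  assumes "n > 0" and "m > 0" and "coprime n m"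
  shows "equivariant_bijection n m (xhat n m)
           (classes n m) (class_dom n m) (class_act n m)
           (Lambda0_orbit n m) (\<lambda>\<alpha>. Lambda0_orbit n m \<inter> hyperplane n m \<alpha>) (tau n m)
       \<and> xhat n m (cls n m empty_part 0) = Lambda0 n m"
proof -
  interpret coprime_pair n m using assms by unfold_locales
  show ?thesis using xhat_equivariant_bijection xhat_empty by simp
qed

end
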